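(* Let $r$ be a positive integer and let $P$ be a pure $r$-cubical poset of rank $n$. If $P$ is C-shellable, then $P$ has a nonnegative $r$-cubical $h$-vector, that is, there are real numbers $h_0,\dots,h_n\ge0$ such that $$\sum_{x\in P}t^{\rho(x)}=\sum_{k=0}^n h_k\,R_{n,k}(t),$$ where $R_{0,0}(t)=1$ and, for $n\ge1$, $R_{n,0}(t)=1+t(r+t)^{n-1}$, $R_{n,k}(t)=(r-1+t)\,t^k(r+t)^{n-k-1}$ for $0<k<n$, and $R_{n,n}(t)=t^n$. In particular, $P$ is $\mathbf{C}_r$-positive.
   Context: $r$-cubical posets: let $M_r$ be the poset consisting of an antichain $[r]=\{1,\dots,r\}$ together with a largest element $z$. The infinite $r$-cubical lattice $\mathbf{C}_r$ consists of a least element $\hat0$ together with all sequences $x=(\xi_1,\xi_2,\dots)$ with $\xi_i\in M_r$ and $\xi_i\in[r]$ for all but finitely many $i$, ordered coordinatewise. The rank of a sequence $x$ is $\rho(x)=1+|\{i:\xi_i=z\}|$ and $\rho(\hat0)=0$. For $x\in\mathbf{C}_r$ of rank $n$, the interval $[\hat0,x]$ is an $r$-cube of rank $n$. A finite poset $P$ with a least element $\hat0$ is $r$-cubical if every principal order ideal $\langle x\rangle=\{z'\in P:z'\le x\}$ is isomorphic to an $r$-cube; $\rho(x)$ is the rank of that cube and the rank $\rho(P)$ of $P$ is the maximal rank of an element. The $r$-cubical $h$-vector of $P$ is the vector of coefficients $(h_0,\dots,h_n)$ in the expansion displayed in the claim, and $\mathbf{C}_r$-positive means such an expansion exists with all $h_k\ge0$.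 C-shellability: a finite poset is pure if all its maximal chains have the same length; facets are maximal elements. Let $P$ be a pure poset with least element $\hat0$. An ordering $x_1,\dots,x_m$ of the facets of $P$ is a C-shelling if $P$ has rank at most one, or the rank of $P$ is at least two and (S1) for each $j>1$, the subposet $H_j=\langle x_j\rangle\cap\bigcup_{i<j}\langle x_i\rangle$ of $\langle x_j\rangle$ is pure of rank $\rho(P)-1$; and (S2) for each $j$, $[\hat0,x_j)=\{x\in P:x<x_j\}$ has a C-shelling, and if $j>1$ it has a C-shelling for which the facets of $H_j$ come first. $P$ is C-shellable if it has a C-shelling. *)

theory Defs
  imports Complex_Main "HOL-Computational_Algebra.Polynomial"
begin

text \<open>A poset is a carrier set together with an order relation that is only constrained on the
  carrier, so that a subposet is given by a smaller carrier and the same relation.\<close>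

definition finite_poset :: "'a set \<Rightarrow> ('a \<Rightarrow> 'a \<Rightarrow> bool) \<Rightarrow> bool" where
  "finite_poset A le \<longleftrightarrow> finite A \<and> reflp_on A le \<and> transp_on A le \<and> antisymp_on A le"

definition has_least :: "'a set \<Rightarrow> ('a \<Rightarrow> 'a \<Rightarrow> bool) \<Rightarrow> bool" where
  "has_least A le \<longleftrightarrow> (\<exists>b\<in>A. \<forall>x\<in>A. le b x)"

definition principal_ideal :: "'a set \<Rightarrow> ('a \<Rightarrow> 'a \<Rightarrow> bool) \<Rightarrow> 'a \<Rightarrow> 'a set" where
  "principal_ideal A le x = {y \<in> A. le y x}"

text \<open>In a poset with least element \<open>b\<close> this is the half-open interval \<open>[b, x)\<close>.\<close>

definition strictly_below :: "'a set \<Rightarrow> ('a \<Rightarrow> 'a \<Rightarrow> bool) \<Rightarrow> 'a \<Rightarrow> 'a set" where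
  "strictly_below A le x = {y \<in> A. le y x \<and> y \<noteq> x}"

definition facets :: "'a set \<Rightarrow> ('a \<Rightarrow> 'a \<Rightarrow> bool) \<Rightarrow> 'a set" where
  "facets A le = {x \<in> A. \<forall>y\<in>A. le x y \<longrightarrow> y = x}"

definition poset_isomorphic ::
  "'a set \<Rightarrow> ('a \<Rightarrow> 'a \<Rightarrow> bool) \<Rightarrow> 'b set \<Rightarrow> ('b \<Rightarrow> 'b \<Rightarrow> bool) \<Rightarrow> bool" where
  "poset_isomorphic A le B le' \<longleftrightarrow>
     (\<exists>f. bij_betw f A B \<and> (\<forall>x\<in>A. \<forall>y\<in>A. le x y \<longleftrightarrow> le' (f x) (f y)))"

definition pure_poset :: "'a set \<Rightarrow> ('a \<Rightarrow> 'a \<Rightarrow> bool) \<Rightarrow> bool" where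
  "pure_poset A le \<longleftrightarrow> finite_poset A le \<and>
     (\<forall>C D. pred_on.maxchain A le C \<longrightarrow> pred_on.maxchain A le D \<longrightarrow> card C = card D)"

text \<open>The length of a longest chain, a chain with \<open>k + 1\<close> elements having length \<open>k\<close>. For a pure
  poset this is the common length of its maximal chains.\<close>

definition poset_rank :: "'a set \<Rightarrow> ('a \<Rightarrow> 'a \<Rightarrow> bool) \<Rightarrow> nat" where
  "poset_rank A le = Max (card ` {C. pred_on.chain A le C}) - 1"


subsection \<open>The infinite \<open>r\<close>-cubical lattice\<close>

datatype M_elem = Atom nat | Z

definition M_set :: "nat \<Rightarrow> M_elem set" where
  "M_set r = insert Z (Atom ` {1..r})"

definition M_le :: "M_elem \<Rightarrow> M_elem \<Rightarrow> bool" where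
  "M_le a b \<longleftrightarrow> a = b \<or> b = Z"

text \<open>\<open>None\<close> is the least element; \<open>Some \<xi>\<close> is the sequence \<open>\<xi>\<close>, indexed from \<open>0\<close>.\<close>

type_synonym C_elem = "(nat \<Rightarrow> M_elem) option"

definition C_set :: "nat \<Rightarrow> C_elem set" where
  "C_set r = insert None (Some ` {\<xi>. (\<forall>i. \<xi> i \<in> M_set r) \<and> finite {i. \<xi> i \<notin> Atom ` {1..r}}})"

fun C_le :: "C_elem \<Rightarrow> C_elem \<Rightarrow> bool" where
  "C_le None y = True"
| "C_le (Some \<xi>) None = False"
| "C_le (Some \<xi>) (Some \<eta>) = (\<forall>i. M_le (\<xi> i) (\<eta> i))"

fun C_rank :: "C_elem \<Rightarrow> nat" where
  "C_rank None = 0"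
| "C_rank (Some \<xi>) = 1 + card {i. \<xi> i = Z}"


subsection \<open>\<open>r\<close>-cubical posets\<close>

definition iso_cube :: "nat \<Rightarrow> nat \<Rightarrow> 'a set \<Rightarrow> ('a \<Rightarrow> 'a \<Rightarrow> bool) \<Rightarrow> bool" where
  "iso_cube r m A le \<longleftrightarrow>
     (\<exists>y\<in>C_set r. C_rank y = m \<and> poset_isomorphic A le (principal_ideal (C_set r) C_le y) C_le)"

definition r_cubical :: "nat \<Rightarrow> 'a set \<Rightarrow> ('a \<Rightarrow> 'a \<Rightarrow> bool) \<Rightarrow> bool" where
  "r_cubical r P le \<longleftrightarrow> finite_poset P le \<and> has_least P le \<and>
     (\<forall>x\<in>P. \<exists>m. iso_cube r m (principal_ideal P le x) le)"

text \<open>The rank of the cube is determined for \<open>r \<ge> 1\<close>: a cube of rank \<open>m \<ge> 1\<close> has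
  \<open>1 + (r + 1) ^ (m - 1)\<close> elements, and a cube of rank \<open>0\<close> has one.\<close>

definition cubical_rho :: "nat \<Rightarrow> 'a set \<Rightarrow> ('a \<Rightarrow> 'a \<Rightarrow> bool) \<Rightarrow> 'a \<Rightarrow> nat" where
  "cubical_rho r P le x = (THE m. iso_cube r m (principal_ideal P le x) le)"

definition cubical_rank :: "nat \<Rightarrow> 'a set \<Rightarrow> ('a \<Rightarrow> 'a \<Rightarrow> bool) \<Rightarrow> nat" where
  "cubical_rank r P le = Max (cubical_rho r P le ` P)"


subsection \<open>C-shellability\<close>

text \<open>\<open>shelling_H A le xs j\<close> is the intersection of the ideal of the \<open>j\<close>-th facet with the union of
  the ideals of the earlier ones. Lists are indexed from \<open>0\<close>, so the first facet is \<open>xs ! 0\<close>.\<close>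

definition shelling_H :: "'a set \<Rightarrow> ('a \<Rightarrow> 'a \<Rightarrow> bool) \<Rightarrow> 'a list \<Rightarrow> nat \<Rightarrow> 'a set" where
  "shelling_H A le xs j =
     principal_ideal A le (xs ! j) \<inter> (\<Union>i<j. principal_ideal A le (xs ! i))"

text \<open>The recursion passes from \<open>A\<close> to the proper subsets \<open>strictly_below A le (xs ! j)\<close> of the
  finite set \<open>A\<close>, so it is well-founded. In the last premise of \<open>step\<close>, the initial segment \<open>us\<close>
  of the C-shelling \<open>us @ vs\<close> consists of the facets of \<open>shelling_H A le xs j\<close>.\<close>

inductive C_shelling :: "('a \<Rightarrow> 'a \<Rightarrow> bool) \<Rightarrow> 'a set \<Rightarrow> 'a list \<Rightarrow> bool"
  for le :: "'a \<Rightarrow> 'a \<Rightarrow> bool" where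
  low_rank:
    "\<lbrakk>pure_poset A le; has_least A le; distinct xs; set xs = facets A le; poset_rank A le \<le> 1\<rbrakk>
     \<Longrightarrow> C_shelling le A xs"
| step:
    "\<lbrakk>pure_poset A le; has_least A le; distinct xs; set xs = facets A le; 2 \<le> poset_rank A le;
      \<forall>j. 0 < j \<and> j < length xs \<longrightarrow>
        pure_poset (shelling_H A le xs j) le \<and>
        poset_rank (shelling_H A le xs j) le = poset_rank A le - 1;
      \<forall>j<length xs. \<exists>ys. C_shelling le (strictly_below A le (xs ! j)) ys;
      \<forall>j. 0 < j \<and> j < length xs \<longrightarrow>
        (\<exists>us vs. C_shelling le (strictly_below A le (xs ! j)) (us @ vs) \<and>
                 set us = facets (shelling_H A le xs j) le)\<rbrakk>
     \<Longrightarrow> C_shelling le A xs"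

definition C_shellable :: "'a set \<Rightarrow> ('a \<Rightarrow> 'a \<Rightarrow> bool) \<Rightarrow> bool" where
  "C_shellable P le \<longleftrightarrow> (\<exists>xs. C_shelling le P xs)"


subsection \<open>The \<open>r\<close>-cubical \<open>h\<close>-vector\<close>

text \<open>Here \<open>[:c, 1:]\<close> is the polynomial \<open>c + t\<close>. Only the values for \<open>k \<le> n\<close> are meaningful.\<close>

definition R_poly :: "nat \<Rightarrow> nat \<Rightarrow> nat \<Rightarrow> real poly" where
  "R_poly r n k =
     (if n = 0 then 1
      else if k = 0 then 1 + [:0, 1:] * [:real r, 1:] ^ (n - 1)
      else if k < n then [:real r - 1, 1:] * [:0, 1:] ^ k * [:real r, 1:] ^ (n - k - 1)
      else [:0, 1:] ^ n)"

definition rank_generating_poly :: "nat \<Rightarrow> 'a set \<Rightarrow> ('a \<Rightarrow> 'a \<Rightarrow> bool) \<Rightarrow> real poly" where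
  "rank_generating_poly r P le = (\<Sum>x\<in>P. [:0, 1:] ^ cubical_rho r P le x)"

text \<open>A vector \<open>(h\<^sub>0, \<dots>, h\<^sub>n)\<close> is encoded by a function of which only the values at \<open>k \<le> n\<close>
  matter. For \<open>r = 1\<close> it need not be unique, hence a predicate.\<close>

definition is_cubical_h_vector ::
  "nat \<Rightarrow> 'a set \<Rightarrow> ('a \<Rightarrow> 'a \<Rightarrow> bool) \<Rightarrow> (nat \<Rightarrow> real) \<Rightarrow> bool" where
  "is_cubical_h_vector r P le h \<longleftrightarrow>
     rank_generating_poly r P le =
       (\<Sum>k\<le>cubical_rank r P le. smult (h k) (R_poly r (cubical_rank r P le) k))"

definition C_positive :: "nat \<Rightarrow> 'a set \<Rightarrow> ('a \<Rightarrow> 'a \<Rightarrow> bool) \<Rightarrow> bool" where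
  "C_positive r P le \<longleftrightarrow>
     (\<exists>h. is_cubical_h_vector r P le h \<and> (\<forall>k\<le>cubical_rank r P le. 0 \<le> h k))"

end

theory Submission
  imports Defs "HOL-Library.FuncSet"
begin

text \<open>A shelling cuts \<open>P\<close> into pieces \<open>\<langle>x\<^sub>j\<rangle> - H\<^sub>j\<close>. The first one is a full cube and contributes
  \<open>R\<^sub>n\<^sub>,\<^sub>0\<close>. For \<open>j > 1\<close> the coatoms of the cube \<open>\<langle>x\<^sub>j\<rangle>\<close> are given by a direction \<open>i\<close> and an atom
  in \<open>[r]\<close>; if \<open>H\<^sub>j\<close> contains \<open>a\<^sub>i\<close> coatoms in direction \<open>i\<close>, the piece contributes
  \<open>t \<Prod>\<^sub>i (t + r - a\<^sub>i)\<close>. The facets of \<open>H\<^sub>j\<close> start a C-shelling of the boundary of the cube, and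
  this forces either some \<open>a\<^sub>i = 1\<close> or all \<open>a\<^sub>i \<ge> 1\<close>: by induction on the dimension this holds for
  the intersection of the last of these facets with the earlier ones, whose profile is \<open>a\<close> with
  the direction of that facet removed. For such profiles, replacing each factor by a nonnegative
  combination of \<open>t + r\<close>, \<open>t + r - 1\<close> and \<open>t\<close> expands the product nonnegatively in the
  polynomials \<open>R\<^sub>n\<^sub>,\<^sub>k\<close> with \<open>k \<ge> 1\<close>.\<close>

section \<open>The cone spanned by the polynomials \<open>R_poly r n k\<close>\<close>

text \<open>Membership amounts to the existence of a nonnegative vector h, so the theorem reduces to
  closure under sums and scalings without tracking coefficients.\<close>

definition R_cone :: "nat \<Rightarrow> nat \<Rightarrow> real poly set" where
  "R_cone r n = {p. \<exists>h. (\<forall>k\<le>n. 0 \<le> h k) \<and> p = (\<Sum>k\<le>n. smult (h k) (R_poly r n k))}"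

lemma R_cone_0: "0 \<in> R_cone r n"
  unfolding R_cone_def by (auto intro!: exI[of _ "\<lambda>_. 0"])

lemma R_cone_add:
  assumes "p \<in> R_cone r n" "q \<in> R_cone r n"
  shows "p + q \<in> R_cone r n"
proof -
  obtain h g where "\<forall>k\<le>n. 0 \<le> h k" "p = (\<Sum>k\<le>n. smult (h k) (R_poly r n k))"
    "\<forall>k\<le>n. 0 \<le> g k" "q = (\<Sum>k\<le>n. smult (g k) (R_poly r n k))"
    using assms unfolding R_cone_def by blast
  then show ?thesis
    unfolding R_cone_def
    by (auto intro!: exI[of _ "\<lambda>k. h k + g k"] simp: smult_add_left sum.distrib)
qed

lemma smult_sum_right: "smult c (\<Sum>i\<in>S. f i) = (\<Sum>i\<in>S. smult c (f i))"
  by (induction S rule: infinite_finite_induct) (simp_all add: smult_add_right)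

lemma R_cone_smult:
  assumes "p \<in> R_cone r n" "0 \<le> c"
  shows "smult c p \<in> R_cone r n"
proof -
  obtain h where "\<forall>k\<le>n. 0 \<le> h k" "p = (\<Sum>k\<le>n. smult (h k) (R_poly r n k))"
    using assms unfolding R_cone_def by blast
  then show ?thesis
    unfolding R_cone_def
    using assms(2) by (auto intro!: exI[of _ "\<lambda>k. c * h k"] simp: smult_sum_right)
qed

lemma R_poly_in_R_cone:
  assumes "k \<le> n"
  shows "R_poly r n k \<in> R_cone r n"
proof -
  have "R_poly r n k = (\<Sum>j\<le>n. if j = k then R_poly r n k else 0)"
    using assms by simp
  also have "\<dots> = (\<Sum>j\<le>n. smult (if j = k then 1 else 0) (R_poly r n j))"
    by (intro sum.cong) auto
  finally show ?thesis
    unfolding R_cone_def by (auto intro!: exI[of _ "\<lambda>j. if j = k then 1 else 0"])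
qed

text \<open>Multiply out one factor at a time: the chosen \<open>u\<close> or \<open>w\<close> moves
  into the prefix \<open>c\<close>, which is therefore generalised in the induction. The last
  premise covers the resulting monomials.\<close>

lemma prod_in_R_cone:
  assumes "finite E"
    and "\<And>i. i \<in> E \<Longrightarrow> \<exists>\<alpha>\<ge>0. \<exists>\<beta>\<ge>0. q i = smult \<alpha> u + smult \<beta> w"
    and "\<And>j. j \<le> card E \<Longrightarrow> c * w ^ j * u ^ (card E - j) \<in> R_cone r n"
  shows "c * prod q E \<in> R_cone r n"
  using assms
proof (induction E arbitrary: c rule: finite_induct)
  case empty
  show ?case using empty(2)[of 0] by simp
next
  case (insert i E)
  obtain \<alpha> \<beta> where ab: "0 \<le> \<alpha>" "0 \<le> \<beta>" "q i = smult \<alpha> u + smult \<beta> w"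
    using insert.prems(1)[of i] by auto
  have "(c * u) * prod q E \<in> R_cone r n"
  proof (rule insert.IH)
    fix j assume j: "j \<le> card E"
    have "c * w ^ j * u ^ (card (insert i E) - j) \<in> R_cone r n"
      using j insert.hyps by (intro insert.prems(2)) auto
    then show "c * u * w ^ j * u ^ (card E - j) \<in> R_cone r n"
      using j insert.hyps by (simp add: Suc_diff_le mult_ac)
  qed (use insert.prems in auto)
  moreover have "(c * w) * prod q E \<in> R_cone r n"
  proof (rule insert.IH)
    fix j assume j: "j \<le> card E"
    have "c * w ^ Suc j * u ^ (card (insert i E) - Suc j) \<in> R_cone r n"
      using j insert.hyps by (intro insert.prems(2)) auto
    then show "c * w * w ^ j * u ^ (card E - j) \<in> R_cone r n"
      using j insert.hyps by (simp add: mult_ac)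
  qed (use insert.prems in auto)
  moreover have "c * prod q (insert i E)
      = smult \<alpha> ((c * u) * prod q E) + smult \<beta> ((c * w) * prod q E)"
    using insert.hyps by (simp add: ab algebra_simps)
  ultimately show ?case
    using ab by (simp only: R_cone_add R_cone_smult)
qed

text \<open>Every \<open>t + r - a\<close> is a nonnegative combination of \<open>t + r\<close> and \<open>t\<close>, and for \<open>a \<ge> 1\<close> even of
  \<open>t + r - 1\<close> and \<open>t\<close>. It would not suffice that \<open>a\<close> is nonzero somewhere: for \<open>r \<ge> 2\<close> the
  profile \<open>(r, 0)\<close> gives \<open>t * t * (t + r)\<close>, which is not in the cone.\<close>

lemma profile_in_R_cone:
  fixes a :: "nat \<Rightarrow> nat"
  assumes "1 \<le> r" "finite D" "D \<noteq> {}" "\<And>i. i \<in> D \<Longrightarrow> a i \<le> r"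
    and profile: "(\<exists>i\<in>D. a i = 1) \<or> (\<forall>i\<in>D. a i \<noteq> 0)"
  shows "[:0, 1:] * (\<Prod>i\<in>D. [:real r - real (a i), 1:]) \<in> R_cone r (Suc (card D))"
    (is "?t * _ \<in> ?K")
proof -
  let ?u = "[:real r, 1:]" and ?v = "[:real r - 1, 1:]"
  define n where "n = Suc (card D)"
  \<comment> \<open>These are the R_{n,j+1} with n = card D + 1 and 0 < j + 1 < n.\<close>
  have basis: "?t * ?v * ?t ^ j * ?u ^ (card D - 1 - j) \<in> ?K" if "j \<le> card D - 1" for j
  proof -
    have "0 < card D" using assms by (simp add: card_gt_0_iff)
    with that have "R_poly r n (Suc j) = ?t * ?v * ?t ^ j * ?u ^ (card D - 1 - j)"
      unfolding R_poly_def n_def by (auto simp del: mult_pCons_left mult_pCons_right simp: mult_ac)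
    then show ?thesis
      using R_poly_in_R_cone[of "Suc j" n r] that \<open>0 < card D\<close> unfolding n_def by auto
  qed
  \<comment> \<open>t + r - b = (1 - b/r)(t + r) + (b/r) t.\<close>
  have uw: "\<exists>\<alpha>\<ge>0. \<exists>\<beta>\<ge>0. [:real r - real b, 1:] = smult \<alpha> ?u + smult \<beta> ?t" if "b \<le> r" for b
    using assms(1) that
    by (intro exI[of _ "(real r - real b) / real r"] exI[of _ "real b / real r"] conjI)
      (auto simp: field_simps)
  show ?thesis
    using profile
  proof
    assume "\<exists>i\<in>D. a i = 1"
    then obtain i where i: "i \<in> D" "a i = 1" by blast
    \<comment> \<open>The factor with \<open>a i = 1\<close> is r - 1 + t, which all R_{n,k} with 0
      < k < n contain; the other factors are expanded in t + r and t.\<close>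
    have "?t * ?v * (\<Prod>i\<in>D - {i}. [:real r - real (a i), 1:]) \<in> ?K"
    proof (rule prod_in_R_cone[where u = ?u and w = ?t])
      show "finite (D - {i})" using assms by simp
    next
      fix k assume "k \<in> D - {i}"
      then show "\<exists>\<alpha>\<ge>0. \<exists>\<beta>\<ge>0. [:real r - real (a k), 1:] = smult \<alpha> ?u + smult \<beta> ?t"
        using assms(4) by (intro uw) auto
    next
      fix j assume "j \<le> card (D - {i})"
      then show "?t * ?v * ?t ^ j * ?u ^ (card (D - {i}) - j) \<in> ?K"
        using basis[of j] i assms by simp
    qed
    moreover have "(\<Prod>i\<in>D. [:real r - real (a i), 1:])
        = ?v * (\<Prod>i\<in>D - {i}. [:real r - real (a i), 1:])"
      using prod.remove[of D i "\<lambda>i. [:real r - real (a i), 1:]"] i assms by simp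
    ultimately show ?thesis by (simp only: mult.assoc)
  next
    assume pos: "\<forall>i\<in>D. a i \<noteq> 0"
    show ?thesis
    proof (rule prod_in_R_cone[where u = ?v and w = ?t])
      show "finite D" using assms by simp
    next
      fix k assume k: "k \<in> D"
      then have "1 \<le> a k" "a k \<le> r" using pos assms(4) by auto
      then show "\<exists>\<alpha>\<ge>0. \<exists>\<beta>\<ge>0. [:real r - real (a k), 1:] = smult \<alpha> ?v + smult \<beta> ?t"
      proof (cases "r = 1")
        \<comment> \<open>For r = 1 the denominators used below vanish, but then
          \<open>a k = 1\<close> and the factor is \<open>?v\<close> itself.\<close>
        case True
        then show ?thesis
          using \<open>1 \<le> a k\<close> \<open>a k \<le> r\<close> by (intro exI[of _ 1] exI[of _ 0] conjI) auto
      next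
        case False
        then have "real r - 1 > 0" using assms(1) by simp
        then show ?thesis
          using \<open>1 \<le> a k\<close> \<open>a k \<le> r\<close>
          by (intro exI[of _ "(real r - real (a k)) / (real r - 1)"]
              exI[of _ "(real (a k) - 1) / (real r - 1)"] conjI)
            (auto simp: add_divide_distrib[symmetric])
      qed
    next
      fix j assume j: "j \<le> card D"
      show "?t * ?t ^ j * ?v ^ (card D - j) \<in> ?K"
      \<comment> \<open>The case j = card D gives t^n = R_{n,n}. Otherwise one factor
        \<open>?v\<close> is kept and the remaining card D - 1 - j are expanded further in t + r and
        t.\<close>
      proof (cases "j = card D")
        case True
        then have "?t * ?t ^ j * ?v ^ (card D - j) = R_poly r n n"
          unfolding R_poly_def n_def by simp
        then show ?thesis
          using R_poly_in_R_cone[of n n r] unfolding n_def by simp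
      next
        case False
        let ?e = "card D - 1 - j"
        have "(?t * ?t ^ j * ?v) * (\<Prod>i<?e. ?v) \<in> ?K"
        proof (rule prod_in_R_cone[where u = ?u and w = ?t])
          fix k
          show "\<exists>\<alpha>\<ge>0. \<exists>\<beta>\<ge>0. ?v = smult \<alpha> ?u + smult \<beta> ?t"
            using uw[of 1] assms by simp
        next
          fix l assume "l \<le> card {..<?e}"
          then show "(?t * ?t ^ j * ?v) * ?t ^ l * ?u ^ (card {..<?e} - l) \<in> ?K"
            using basis[of "j + l"] j False
            by (simp del: mult_pCons_left mult_pCons_right add: mult_ac power_add)
        qed simp
        moreover have "card D - j = Suc ?e" using j False by simp
        ultimately show ?thesis
          by (simp del: mult_pCons_left mult_pCons_right add: mult_ac)
      qed
    qed
  qed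
qed


section \<open>Cubes in coordinates\<close>

abbreviation zs :: "(nat \<Rightarrow> M_elem) \<Rightarrow> nat set" where
  "zs \<xi> \<equiv> {i. \<xi> i = Z}"

text \<open>Coordinates where \<eta> is \<open>Z\<close> are free within \<open>B\<close>, the
  others are frozen. With all of \<open>M_set r\<close> allowed this is the cube below \<eta>
  without its least element; removing atoms from the \<open>B i\<close> removes everything below the
  corresponding coatoms.\<close>

definition box :: "(nat \<Rightarrow> M_elem) \<Rightarrow> (nat \<Rightarrow> M_elem set) \<Rightarrow> (nat \<Rightarrow> M_elem) set" where
  "box \<eta> B = {\<xi>. \<forall>i. if \<eta> i = Z then \<xi> i \<in> B i else \<xi> i = \<eta> i}"

lemma C_le_refl: "C_le x x"
  by (cases x) (auto simp: M_le_def)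

lemma C_le_antisym: "C_le x y \<Longrightarrow> C_le y x \<Longrightarrow> x = y"
  by (cases x; cases y) (auto simp: M_le_def fun_eq_iff, metis)

lemma C_le_trans: "C_le x y \<Longrightarrow> C_le y w \<Longrightarrow> C_le x w"
  by (cases x; cases y; cases w) (auto simp: M_le_def, metis)

lemma Some_in_C_set: "Some \<xi> \<in> C_set r \<longleftrightarrow> (\<forall>i. \<xi> i \<in> M_set r) \<and> finite (zs \<xi>)"
proof -
  have "{i. \<xi> i \<notin> Atom ` {1..r}} = zs \<xi>" if "\<forall>i. \<xi> i \<in> M_set r"
    using that unfolding M_set_def by auto
  then show ?thesis
    unfolding C_set_def by auto
qed

lemma C_ideal_Some:
  assumes "Some \<eta> \<in> C_set r"
  shows "principal_ideal (C_set r) C_le (Some \<eta>) = insert None (Some ` box \<eta> (\<lambda>_. M_set r))"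
proof (intro set_eqI iffI)
  fix y assume "y \<in> principal_ideal (C_set r) C_le (Some \<eta>)"
  then show "y \<in> insert None (Some ` box \<eta> (\<lambda>_. M_set r))"
    unfolding principal_ideal_def
    by (cases y) (auto simp: Some_in_C_set box_def M_le_def)
next
  fix y assume y: "y \<in> insert None (Some ` box \<eta> (\<lambda>_. M_set r))"
  show "y \<in> principal_ideal (C_set r) C_le (Some \<eta>)"
  proof (cases y)
    case None
    then show ?thesis unfolding principal_ideal_def C_set_def by simp
  next
    case (Some \<xi>)
    then have \<xi>: "\<forall>i. if \<eta> i = Z then \<xi> i \<in> M_set r else \<xi> i = \<eta> i"
      using y unfolding box_def by auto
    then have "zs \<xi> \<subseteq> zs \<eta>" by auto metis
    then have "finite (zs \<xi>)" using assms by (auto simp: Some_in_C_set intro: finite_subset)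
    moreover have "\<forall>i. \<xi> i \<in> M_set r" using \<xi> assms by (metis Some_in_C_set)
    ultimately show ?thesis
      using Some \<xi> unfolding principal_ideal_def by (auto simp: Some_in_C_set M_le_def)
  qed
qed

text \<open>Only the free coordinates vary, so a box becomes a product of sets, to which counting
  and distributivity for \<open>PiE\<close> apply.\<close>

lemma bij_betw_box: "bij_betw (\<lambda>\<xi>. restrict \<xi> (zs \<eta>)) (box \<eta> B) (PiE (zs \<eta>) B)"
proof (rule bij_betw_byWitness[where f' = "\<lambda>g i. if \<eta> i = Z then g i else \<eta> i"])
  show "\<forall>\<xi>\<in>box \<eta> B. (\<lambda>i. if \<eta> i = Z then restrict \<xi> (zs \<eta>) i else \<eta> i) = \<xi>"
    by (auto simp: box_def fun_eq_iff)
  show "\<forall>g\<in>PiE (zs \<eta>) B. restrict (\<lambda>i. if \<eta> i = Z then g i else \<eta> i) (zs \<eta>) = g"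
    by (auto simp: fun_eq_iff restrict_def PiE_iff extensional_def)
qed (auto simp: box_def split: if_splits)

lemma sum_prod_box:
  fixes F :: "M_elem \<Rightarrow> 'b :: comm_semiring_1"
  assumes "finite (zs \<eta>)" "\<And>i. i \<in> zs \<eta> \<Longrightarrow> finite (B i)"
  shows "(\<Sum>\<xi>\<in>box \<eta> B. \<Prod>i\<in>zs \<eta>. F (\<xi> i)) = (\<Prod>i\<in>zs \<eta>. \<Sum>m\<in>B i. F m)"
proof -
  have "(\<Sum>\<xi>\<in>box \<eta> B. \<Prod>i\<in>zs \<eta>. F (\<xi> i))
      = (\<Sum>\<xi>\<in>box \<eta> B. \<Prod>i\<in>zs \<eta>. F (restrict \<xi> (zs \<eta>) i))"
    by (intro sum.cong prod.cong) auto
  also have "\<dots> = (\<Sum>g\<in>PiE (zs \<eta>) B. \<Prod>i\<in>zs \<eta>. F (g i))"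
    by (rule sum.reindex_bij_betw[OF bij_betw_box])
  also have "\<dots> = (\<Prod>i\<in>zs \<eta>. \<Sum>m\<in>B i. F m)"
    by (rule prod_sum_PiE[symmetric, OF assms])
  finally show ?thesis .
qed

section \<open>Cardinalities and rank generating polynomials of cubes\<close>

lemma finite_M_set: "finite (M_set r)"
  unfolding M_set_def by simp

lemma card_M_set: "card (M_set r) = Suc r"
proof -
  have "card (Atom ` {1..r}) = r" by (subst card_image) (auto simp: inj_on_def)
  then show ?thesis unfolding M_set_def by (subst card_insert_disjoint) auto
qed

lemma finite_box: "finite (zs \<eta>) \<Longrightarrow> (\<And>i. finite (B i)) \<Longrightarrow> finite (box \<eta> B)"
  using bij_betw_finite[OF bij_betw_box[of \<eta> B]] by (simp add: finite_PiE)

text \<open>Each free coordinate takes r + 1 values, and the extra 1 is the least element. This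
  count makes the rank of a cube an isomorphism invariant.\<close>

lemma card_C_ideal:
  assumes "y \<in> C_set r"
  shows "card (principal_ideal (C_set r) C_le y)
    = (if C_rank y = 0 then 1 else 1 + Suc r ^ (C_rank y - 1))"
proof (cases y)
  case None
  have "principal_ideal (C_set r) C_le None = {None}"
  proof (intro set_eqI iffI)
    fix w assume "w \<in> principal_ideal (C_set r) C_le None"
    then show "w \<in> {None}" by (cases w) (auto simp: principal_ideal_def)
  qed (auto simp: principal_ideal_def C_set_def)
  then show ?thesis using None by simp
next
  case (Some \<eta>)
  then have fin: "finite (zs \<eta>)" and C: "Some \<eta> \<in> C_set r"
    using assms by (auto simp: Some_in_C_set)
  have "card (box \<eta> (\<lambda>_. M_set r)) = Suc r ^ card (zs \<eta>)"
    using bij_betw_same_card[OF bij_betw_box[of \<eta> "\<lambda>_. M_set r"]] fin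
    by (simp add: card_PiE card_M_set)
  moreover have "finite (box \<eta> (\<lambda>_. M_set r))"
    using fin by (intro finite_box finite_M_set)
  ultimately show ?thesis
    unfolding Some C_ideal_Some[OF C]
    by (subst card_insert_disjoint) (auto simp: card_image)
qed

text \<open>The rank is one more than the number of \<open>Z\<close>, so t^rank is t times a product
  of weights, t for \<open>Z\<close> and 1 for an atom. Direction i contributes t plus 1 for each of
  its r - card (B i) remaining atoms.\<close>

lemma sum_C_rank_box:
  assumes "finite (zs \<eta>)" "\<And>i. B i \<subseteq> {1..r}"
  shows "(\<Sum>\<xi>\<in>box \<eta> (\<lambda>i. M_set r - Atom ` B i). [:0, 1:] ^ C_rank (Some \<xi>))
    = ([:0, 1:] * (\<Prod>i\<in>zs \<eta>. [:real r - real (card (B i)), 1:]) :: real poly)"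
proof -
  let ?t = "[:0, 1:] :: real poly"
  define F where "F m = (if m = Z then ?t else 1)" for m
  have "?t ^ C_rank (Some \<xi>) = ?t * (\<Prod>i\<in>zs \<eta>. F (\<xi> i))"
    if "\<xi> \<in> box \<eta> (\<lambda>i. M_set r - Atom ` B i)" for \<xi>
  proof -
    have "zs \<xi> = {i \<in> zs \<eta>. \<xi> i = Z}"
      using that unfolding box_def by (auto, metis)
    moreover have "(\<Prod>i\<in>zs \<eta>. F (\<xi> i)) = ?t ^ card {i \<in> zs \<eta>. \<xi> i = Z}"
      unfolding F_def using assms(1) by (subst prod.inter_filter[symmetric]) auto
    ultimately show ?thesis by (simp del: mult_pCons_left mult_pCons_right)
  qed
  then have "(\<Sum>\<xi>\<in>box \<eta> (\<lambda>i. M_set r - Atom ` B i). ?t ^ C_rank (Some \<xi>))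
      = ?t * (\<Sum>\<xi>\<in>box \<eta> (\<lambda>i. M_set r - Atom ` B i). \<Prod>i\<in>zs \<eta>. F (\<xi> i))"
    by (simp add: sum_distrib_left del: mult_pCons_left mult_pCons_right)
  also have "\<dots> = ?t * (\<Prod>i\<in>zs \<eta>. \<Sum>m\<in>M_set r - Atom ` B i. F m)"
    using assms(1) by (subst sum_prod_box) (auto simp: finite_M_set)
  also have "(\<lambda>i. \<Sum>m\<in>M_set r - Atom ` B i. F m)
      = (\<lambda>i. [:real r - real (card (B i)), 1:])"
  proof
    fix i
    have "M_set r - Atom ` B i = insert Z (Atom ` ({1..r} - B i))"
      unfolding M_set_def by auto
    then have "(\<Sum>m\<in>M_set r - Atom ` B i. F m) = (\<Sum>m\<in>insert Z (Atom ` ({1..r} - B i)). F m)"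
      by simp
    also have "\<dots> = ?t + (\<Sum>m\<in>Atom ` ({1..r} - B i). F m)"
      by (subst sum.insert) (auto simp: F_def)
    also have "(\<Sum>m\<in>Atom ` ({1..r} - B i). F m) = of_nat (card ({1..r} - B i))"
      by (subst sum.reindex) (auto simp: inj_on_def F_def)
    also have "card ({1..r} - B i) = r - card (B i)"
      using assms(2)[of i] by (subst card_Diff_subset) (auto intro: finite_subset)
    also have "real (r - card (B i)) = real r - real (card (B i))"
      using card_mono[OF _ assms(2)[of i]] by simp
    then have "?t + of_nat (r - card (B i)) = [:real r - real (card (B i)), 1:]"
      by (simp add: of_nat_poly)
    finally show "(\<Sum>m\<in>M_set r - Atom ` B i. F m) = [:real r - real (card (B i)), 1:]" .
  qed
  finally show ?thesis .
qed

lemma C_rank_strict_mono: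
  assumes "y \<in> C_set r" "C_le x y" "x \<noteq> y"
  shows "C_rank x < C_rank y"
proof (cases y)
  case None
  then show ?thesis using assms by (cases x) auto
next
  case y: (Some \<eta>)
  show ?thesis
  proof (cases x)
    case None
    then show ?thesis using y by simp
  next
    case (Some \<xi>)
    have le: "\<And>i. M_le (\<xi> i) (\<eta> i)" using assms y Some by simp
    obtain i where "\<xi> i \<noteq> \<eta> i" using assms y Some by (auto simp: fun_eq_iff)
    then have "i \<in> zs \<eta> - zs \<xi>" using le[of i] by (auto simp: M_le_def)
    moreover have "zs \<xi> \<subseteq> zs \<eta>" using le unfolding M_le_def by force
    ultimately have "zs \<xi> \<subset> zs \<eta>" by blast
    then show ?thesis
      using y Some assms by (auto simp: Some_in_C_set intro: psubset_card_mono)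
  qed
qed

section \<open>Coatoms of a cube\<close>

lemma coatom_in_C_ideal:
  assumes "Some \<eta> \<in> C_set r" "\<eta> i = Z" "a \<in> {1..r}"
  shows "Some (\<eta>(i := Atom a)) \<in> principal_ideal (C_set r) C_le (Some \<eta>)"
  using assms unfolding C_ideal_Some[OF assms(1)]
  by (auto simp: box_def M_set_def Some_in_C_set)

lemma zs_upd: "zs (\<eta>(i := Atom a)) = zs \<eta> - {i}"
  by auto

text \<open>Only coordinate i matters, since the others are controlled by \<xi> \<le> \<eta>, and
  below an atom of M_r there is only that atom.\<close>

lemma C_le_coatom:
  assumes "C_le (Some \<xi>) (Some \<eta>)" "\<eta> i = Z"
  shows "C_le (Some \<xi>) (Some (\<eta>(i := Atom a))) \<longleftrightarrow> \<xi> i = Atom a"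
  using assms by (auto simp: M_le_def)

lemma coatom_cover:
  assumes "C_le (Some (\<eta>(i := Atom a))) y" "C_le y (Some \<eta>)"
  shows "y = Some (\<eta>(i := Atom a)) \<or> y = Some \<eta>"
proof (cases y)
  case None
  then show ?thesis using assms by simp
next
  case (Some \<xi>)
  then have *: "\<And>k. M_le ((\<eta>(i := Atom a)) k) (\<xi> k)" "\<And>k. M_le (\<xi> k) (\<eta> k)"
    using assms by auto
  have eq: "\<xi> k = \<eta> k" if "k \<noteq> i" for k
    using *[of k] that by (auto simp: M_le_def)
  show ?thesis
  proof (cases "\<xi> i = \<eta> i")
    case True
    then have "\<xi> = \<eta>" using eq by (metis ext)
    then show ?thesis using Some by simp
  next
    case False
    then have "\<xi> i = Atom a" using *[of i] by (auto simp: M_le_def)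
    then have "\<xi> = \<eta>(i := Atom a)" using eq by auto
    then show ?thesis using Some by simp
  qed
qed

text \<open>The least element lies below every coatom. Any other element has an atom at a coordinate
  where \<eta> has \<open>Z\<close>, and this atom names the coatom.\<close>

lemma ex_coatom_above:
  assumes "1 \<le> r" "y \<in> principal_ideal (C_set r) C_le (Some \<eta>)" "y \<noteq> Some \<eta>" "zs \<eta> \<noteq> {}"
    "Some \<eta> \<in> C_set r"
  shows "\<exists>i\<in>zs \<eta>. \<exists>a\<in>{1..r}. C_le y (Some (\<eta>(i := Atom a)))"
proof (cases y)
  case None
  then show ?thesis using assms by auto
next
  case (Some \<xi>)
  then have "\<xi> \<in> box \<eta> (\<lambda>_. M_set r)" and le: "C_le (Some \<xi>) (Some \<eta>)"
    using assms(2) C_ideal_Some[OF assms(5)] by (auto simp: principal_ideal_def)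
  moreover obtain i where "\<xi> i \<noteq> \<eta> i" using assms Some by (auto simp: fun_eq_iff)
  ultimately have i: "\<eta> i = Z" "\<xi> i \<in> M_set r" "\<xi> i \<noteq> Z"
    unfolding box_def by (auto, metis+)
  then obtain a where "a \<in> {1..r}" "\<xi> i = Atom a" unfolding M_set_def by auto
  then show ?thesis
    using C_le_coatom[OF le i(1), of a] i(1) Some
    by (intro bexI[of _ i] bexI[of _ a]) (simp_all del: fun_upd_apply C_le.simps)
qed


section \<open>Finite posets\<close>

lemma finite_poset_subset: "finite_poset A le \<Longrightarrow> B \<subseteq> A \<Longrightarrow> finite_poset B le"
  unfolding finite_poset_def
  by (meson finite_subset reflp_on_subset transp_on_subset antisymp_on_subset)

lemma ex_facet_above:
  assumes "finite_poset A le" "x \<in> A"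
  shows "\<exists>u\<in>facets A le. le x u"
  using assms(2)
proof (induction "card {y \<in> A. le x y}" arbitrary: x rule: less_induct)
  case less
  note po = assms(1)[unfolded finite_poset_def]
  show ?case
  proof (cases "x \<in> facets A le")
    case True
    then show ?thesis using po less.prems by (auto dest: reflp_onD)
  next
    case False
    then obtain y where y: "y \<in> A" "le x y" "y \<noteq> x"
      using less.prems unfolding facets_def by auto
    have "{w \<in> A. le y w} \<subset> {w \<in> A. le x w}"
    proof
      show "{w \<in> A. le y w} \<subseteq> {w \<in> A. le x w}"
        using po y less.prems by (auto dest: transp_onD)
      have "x \<notin> {w \<in> A. le y w}" "x \<in> {w \<in> A. le x w}"
        using po y less.prems by (auto dest: antisymp_onD reflp_onD)
      then show "{w \<in> A. le y w} \<noteq> {w \<in> A. le x w}" by blast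
    qed
    then have "card {w \<in> A. le y w} < card {w \<in> A. le x w}"
      using po by (intro psubset_card_mono) auto
    then obtain u where "u \<in> facets A le" "le y u" using less.hyps y by blast
    then show ?thesis
      using po y less.prems by (auto simp: facets_def dest: transp_onD)
  qed
qed

lemma card_chain_le_poset_rank:
  assumes "finite A" "pred_on.chain A le C"
  shows "card C - 1 \<le> poset_rank A le"
proof -
  have "{C. pred_on.chain A le C} \<subseteq> Pow A" by (auto simp: pred_on.chain_def)
  then have "finite (card ` {C. pred_on.chain A le C})"
    using assms by (auto intro: finite_subset)
  then have "card C \<le> Max (card ` {C. pred_on.chain A le C})"
    using assms by (intro Max_ge) auto
  then show ?thesis unfolding poset_rank_def by simp
qed

lemma ex_maxchain_superset:
  assumes "finite A" "pred_on.chain A le C"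
  shows "\<exists>D. pred_on.maxchain A le D \<and> C \<subseteq> D"
proof -
  let ?S = "{D. pred_on.chain A le D \<and> C \<subseteq> D}"
  have "?S \<subseteq> Pow A" by (auto simp: pred_on.chain_def)
  then have "finite ?S" using assms by (auto intro: finite_subset)
  moreover have "C \<in> ?S" using assms by simp
  ultimately obtain D where "D \<in> ?S" and max: "\<forall>E\<in>?S. D \<subseteq> E \<longrightarrow> E = D"
    using finite_has_maximal2[of ?S C] by (metis (lifting))
  then show ?thesis
    by (intro exI[of _ D]) (auto simp: pred_on.maxchain_def)
qed

lemma strictly_below_subset: "strictly_below A le x \<subseteq> A"
  unfolding strictly_below_def by auto

text \<open>Half-open intervals are closed downwards, so ideals taken inside them are those of the
  ambient poset. With the next two lemmas, the recursive clauses of \<open>C_shelling\<close> can be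
  read in the ambient poset.\<close>

lemma principal_ideal_strictly_below:
  assumes "finite_poset A le" "x \<in> A" "y \<in> strictly_below A le x"
  shows "principal_ideal (strictly_below A le x) le y = principal_ideal A le y"
  using assms unfolding principal_ideal_def strictly_below_def finite_poset_def
  by (auto dest: transp_onD antisymp_onD)

lemma strictly_below_strictly_below:
  assumes "finite_poset A le" "x \<in> A" "y \<in> strictly_below A le x"
  shows "strictly_below (strictly_below A le x) le y = strictly_below A le y"
  using assms unfolding strictly_below_def finite_poset_def
  by (auto dest: transp_onD antisymp_onD)

lemma shelling_H_strictly_below:
  assumes "finite_poset A le" "x \<in> A" "set xs \<subseteq> strictly_below A le x" "j < length xs"
  shows "shelling_H (strictly_below A le x) le xs j = shelling_H A le xs j"
  using assms unfolding shelling_H_def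
  by (subst principal_ideal_strictly_below) (auto simp: principal_ideal_strictly_below subset_iff)

lemma C_shelling_facets: "C_shelling le A xs \<Longrightarrow> set xs = facets A le \<and> distinct xs"
  by (auto elim: C_shelling.cases)


section \<open>Charts of a cubical poset\<close>

locale cubical_poset =
  fixes r :: nat and P :: "'a set" and le :: "'a \<Rightarrow> 'a \<Rightarrow> bool"
  assumes r_pos: "1 \<le> r" and cubical: "r_cubical r P le"
begin

abbreviation "ideal \<equiv> principal_ideal P le"
abbreviation "rho \<equiv> cubical_rho r P le"
abbreviation "C_ideal \<equiv> principal_ideal (C_set r) C_le"

lemma poset: "finite_poset P le"
  using cubical unfolding r_cubical_def by simp

lemma finite_P: "finite P"
  using poset unfolding finite_poset_def by simp

lemma le_refl: "x \<in> P \<Longrightarrow> le x x"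
  using poset unfolding finite_poset_def by (auto dest: reflp_onD)

lemma le_trans: "\<lbrakk>le x y; le y w; x \<in> P; y \<in> P; w \<in> P\<rbrakk> \<Longrightarrow> le x w"
  using poset unfolding finite_poset_def by (auto dest: transp_onD)

lemma le_antisym: "\<lbrakk>le x y; le y x; x \<in> P; y \<in> P\<rbrakk> \<Longrightarrow> x = y"
  using poset unfolding finite_poset_def by (auto dest: antisymp_onD)

lemma in_ideal: "y \<in> ideal x \<longleftrightarrow> y \<in> P \<and> le y x"
  unfolding principal_ideal_def by simp

text \<open>The top of the target cube is required to be \<open>f x\<close> instead of being a
  separate parameter; this lets the same \<open>f\<close> serve as a chart at every element below
  x.\<close>

definition chart :: "('a \<Rightarrow> C_elem) \<Rightarrow> 'a \<Rightarrow> bool" where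
  "chart f x \<longleftrightarrow> x \<in> P \<and> f x \<in> C_set r \<and> bij_betw f (ideal x) (C_ideal (f x)) \<and>
     (\<forall>y\<in>ideal x. \<forall>w\<in>ideal x. le y w \<longleftrightarrow> C_le (f y) (f w))"

text \<open>The given isomorphism maps onto the ideal of some y; as x is the largest element of its
  own ideal, y must be \<open>f x\<close>.\<close>

lemma ex_chart:
  assumes "x \<in> P"
  shows "\<exists>f. chart f x"
proof -
  obtain m y f where y: "y \<in> C_set r" and f: "bij_betw f (ideal x) (C_ideal y)"
    "\<forall>u\<in>ideal x. \<forall>w\<in>ideal x. le u w \<longleftrightarrow> C_le (f u) (f w)"
    using cubical assms unfolding r_cubical_def iso_cube_def poset_isomorphic_def by meson
  have x: "x \<in> ideal x" using assms le_refl by (simp add: in_ideal)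
  have "y \<in> C_ideal y" using y C_le_refl unfolding principal_ideal_def by simp
  then obtain w where w: "w \<in> ideal x" "f w = y" using f by (metis bij_betw_iff_bijections)
  then have "C_le y (f x)" using f(2) x by (metis in_ideal)
  moreover have "f x \<in> C_ideal y" using f x by (auto simp: bij_betw_def)
  ultimately have "f x = y" using C_le_antisym unfolding principal_ideal_def by auto
  then show ?thesis using f y assms unfolding chart_def by auto
qed

lemma chart_le: "chart f x \<Longrightarrow> y \<in> ideal x \<Longrightarrow> w \<in> ideal x \<Longrightarrow> le y w \<longleftrightarrow> C_le (f y) (f w)"
  unfolding chart_def by blast

lemma chart_in_C_ideal: "chart f x \<Longrightarrow> y \<in> ideal x \<Longrightarrow> f y \<in> C_ideal (f x)"
  unfolding chart_def by (auto simp: bij_betw_def)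

lemma chart_inj: "chart f x \<Longrightarrow> y \<in> ideal x \<Longrightarrow> w \<in> ideal x \<Longrightarrow> f y = f w \<longleftrightarrow> y = w"
  unfolding chart_def by (auto simp: bij_betw_def inj_on_def)

lemma chart_surj: "chart f x \<Longrightarrow> c \<in> C_ideal (f x) \<Longrightarrow> \<exists>y\<in>ideal x. f y = c"
  unfolding chart_def bij_betw_def by (metis imageE)

lemma chart_top: "chart f x \<Longrightarrow> x \<in> ideal x"
  unfolding chart_def by (simp add: in_ideal le_refl)

lemma ideal_trans: "\<lbrakk>w \<in> ideal y; y \<in> ideal x; x \<in> P\<rbrakk> \<Longrightarrow> w \<in> ideal x"
  using le_trans by (auto simp: in_ideal)

text \<open>\<open>f\<close> preserves and reflects the order, so the elements below y go onto those
  below \<open>f y\<close>.\<close>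

lemma chart_restrict:
  assumes "chart f x" "y \<in> ideal x"
  shows "chart f y"
proof -
  have x: "x \<in> P" using assms unfolding chart_def by simp
  have sub: "ideal y \<subseteq> ideal x" using ideal_trans assms x by auto
  have y: "y \<in> P" "f y \<in> C_set r" "C_le (f y) (f x)"
    using assms chart_in_C_ideal[OF assms] by (auto simp: in_ideal principal_ideal_def)
  have "f ` ideal y = C_ideal (f y)"
  proof (intro set_eqI iffI)
    fix c assume "c \<in> f ` ideal y"
    then obtain w where w: "w \<in> ideal y" "c = f w" by auto
    then have "c \<in> C_ideal (f x)" "C_le c (f y)"
      using chart_in_C_ideal[OF assms(1)] chart_le[OF assms(1)] sub assms(2)
      by (auto simp: in_ideal)
    then show "c \<in> C_ideal (f y)" unfolding principal_ideal_def by simp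
  next
    fix c assume c: "c \<in> C_ideal (f y)"
    then have "c \<in> C_ideal (f x)" using y C_le_trans unfolding principal_ideal_def by auto
    then obtain w where w: "w \<in> ideal x" "f w = c" using chart_surj assms by blast
    then have "le w y" using chart_le[OF assms(1) w(1) assms(2)] c
      unfolding principal_ideal_def by simp
    then show "c \<in> f ` ideal y" using w by (auto simp: in_ideal)
  qed
  moreover have "inj_on f (ideal y)"
    using sub chart_inj[OF assms(1)] by (auto simp: inj_on_def)
  moreover have "\<forall>v\<in>ideal y. \<forall>w\<in>ideal y. le v w \<longleftrightarrow> C_le (f v) (f w)"
    using sub chart_le[OF assms(1)] by blast
  ultimately show ?thesis
    using y unfolding chart_def bij_betw_def by blast
qed

section \<open>Ranks of elements and lengths of chains\<close>

lemma iso_cube_unique: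
  assumes "iso_cube r m A le" "iso_cube r m' A le"
  shows "m = m'"
proof -
  \<comment> \<open>Cardinality decides the rank: it is 1 only in rank 0, and otherwise powers of r
    + 1 \<ge> 2 with different exponents differ.\<close>
  have *: "card A = (if k = 0 then 1 else 1 + Suc r ^ (k - 1))" if iso: "iso_cube r k A le" for k
  proof -
    obtain y f where "y \<in> C_set r" "C_rank y = k" "bij_betw f A (C_ideal y)"
      using iso unfolding iso_cube_def poset_isomorphic_def by blast
    then show ?thesis using card_C_ideal[of y r] bij_betw_same_card[of f A] by simp
  qed
  have inj: "Suc r ^ k = Suc r ^ l \<longleftrightarrow> k = l" for k l
    using r_pos by (intro power_inject_exp) simp
  have "card A = 1 \<longleftrightarrow> k = 0" if "iso_cube r k A le" for k
    using *[OF that] by (cases k) simp_all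
  then have zero: "m = 0 \<longleftrightarrow> m' = 0" using assms by blast
  show ?thesis
  proof (cases "m = 0")
    case True
    then show ?thesis using zero by simp
  next
    case False
    then have "Suc r ^ (m - 1) = Suc r ^ (m' - 1)"
      using *[OF assms(1)] *[OF assms(2)] zero by simp
    then show ?thesis using False zero inj[of "m - 1" "m' - 1"] by linarith
  qed
qed

lemma rho_chart:
  assumes "chart f x" "y \<in> ideal x"
  shows "rho y = C_rank (f y)"
proof -
  have "iso_cube r (C_rank (f y)) (ideal y) le"
    using chart_restrict[OF assms]
    unfolding chart_def iso_cube_def poset_isomorphic_def by blast
  then show ?thesis
    unfolding cubical_rho_def by (metis iso_cube_unique the_equality)
qed

lemma rho_strict_mono:
  assumes "y \<in> P" "x \<in> P" "le y x" "y \<noteq> x"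
  shows "rho y < rho x"
proof -
  obtain f where f: "chart f x" using ex_chart assms by blast
  have y: "y \<in> ideal x" using assms by (simp add: in_ideal)
  have "C_rank (f y) < C_rank (f x)"
  proof (rule C_rank_strict_mono)
    show "f x \<in> C_set r" using f unfolding chart_def by blast
    show "C_le (f y) (f x)" using chart_le[OF f y chart_top[OF f]] assms by blast
    show "f y \<noteq> f x" using chart_inj[OF f y chart_top[OF f]] assms by blast
  qed
  then show ?thesis using rho_chart[OF f] y chart_top[OF f] by simp
qed

text \<open>Turning a \<open>Z\<close> into \<open>Atom 1\<close>, which exists as r \<ge> 1, lowers
  the rank by one; if no \<open>Z\<close> is left, the least element has rank 0.\<close>

lemma ex_below_of_rank:
  assumes "x \<in> P" "rho x = Suc m"
  shows "\<exists>y\<in>ideal x. rho y = m"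
proof -
  obtain f where f: "chart f x" using ex_chart assms by blast
  have "C_rank (f x) = Suc m" using rho_chart[OF f chart_top[OF f]] assms by simp
  then obtain \<eta> where \<eta>: "f x = Some \<eta>" "card (zs \<eta>) = m" by (cases "f x") auto
  have C: "Some \<eta> \<in> C_set r" using f \<eta> unfolding chart_def by simp
  have "\<exists>c\<in>C_ideal (f x). C_rank c = m"
  proof (cases "m = 0")
    case True
    then show ?thesis
      using C_ideal_Some[OF C] \<eta> by (intro bexI[of _ None]) auto
  next
    case False
    then obtain i where i: "i \<in> zs \<eta>" using \<eta> by (metis card.empty equals0I)
    have "C_rank (Some (\<eta>(i := Atom 1))) = m"
      using False i \<eta> C by (simp add: zs_upd Some_in_C_set del: fun_upd_apply)
    then show ?thesis
      using coatom_in_C_ideal[OF C, of i 1] i r_pos \<eta>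
      by (intro bexI[of _ "Some (\<eta>(i := Atom 1))"]) simp_all
  qed
  then obtain c where c: "c \<in> C_ideal (f x)" "C_rank c = m" by blast
  then obtain y where "y \<in> ideal x" "f y = c" using chart_surj[OF f] by blast
  then show ?thesis using rho_chart[OF f] c by blast
qed

lemma ex_chain:
  assumes "x \<in> P"
  shows "\<exists>C. pred_on.chain (ideal x) le C \<and> card C = Suc (rho x)"
  using assms
proof (induction "rho x" arbitrary: x)
  case 0
  then show ?case
    by (intro exI[of _ "{x}"]) (auto simp: pred_on.chain_def in_ideal le_refl)
next
  case (Suc m)
  then obtain y where y: "y \<in> ideal x" "rho y = m" using ex_below_of_rank by metis
  then obtain C where C: "pred_on.chain (ideal y) le C" "card C = Suc m"
    using Suc.hyps(1)[of y] by (auto simp: in_ideal)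
  have sub: "C \<subseteq> ideal y" using C by (simp add: pred_on.chain_def)
  have "x \<notin> C"
  proof
    assume "x \<in> C"
    then have "x = y" using sub y le_antisym by (auto simp: in_ideal)
    then show False using Suc.hyps(2) y by simp
  qed
  moreover have "finite C" using C by (simp add: card_ge_0_finite)
  moreover have "ideal y \<subseteq> ideal x" using y ideal_trans Suc.prems by auto
  moreover have "x \<in> ideal x" using Suc.prems by (simp add: in_ideal le_refl)
  ultimately show ?case
    using C sub Suc.hyps(2)
    by (intro exI[of _ "insert x C"]) (auto simp: pred_on.chain_def in_ideal)
qed

text \<open>Links the rank of cubes with \<open>poset_rank\<close>, on which the two rules of
  \<open>C_shelling\<close> depend; it serves to exclude \<open>low_rank\<close>.\<close>

lemma chain_le_poset_rank:
  assumes "A \<subseteq> P" "x \<in> P" "ideal x \<subseteq> A"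
  shows "rho x \<le> poset_rank A le"
proof -
  obtain C where C: "pred_on.chain (ideal x) le C" "card C = Suc (rho x)"
    using ex_chain assms by blast
  then have "pred_on.chain A le C" using assms by (auto simp: pred_on.chain_def)
  moreover have "finite A" using assms finite_P finite_subset by blast
  ultimately show ?thesis using card_chain_le_poset_rank C by fastforce
qed

text \<open>Each element strictly below x lies under a coatom, which is itself strictly below x;
  maximality forces equality.\<close>

lemma facet_below_is_coatom:
  assumes "chart f x" "f x = Some \<eta>" "zs \<eta> \<noteq> {}" "u \<in> facets (strictly_below P le x) le"
  shows "u \<in> ideal x \<and> (\<exists>i\<in>zs \<eta>. \<exists>a\<in>{1..r}. f u = Some (\<eta>(i := Atom a)))"
proof -
  have u: "u \<in> ideal x" "u \<noteq> x"
    using assms(4) by (auto simp: facets_def strictly_below_def in_ideal)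
  have C: "Some \<eta> \<in> C_set r" using assms unfolding chart_def by metis
  have "f u \<in> C_ideal (Some \<eta>)" using chart_in_C_ideal[OF assms(1) u(1)] assms(2) by simp
  moreover have "f u \<noteq> Some \<eta>"
    using chart_inj[OF assms(1) u(1) chart_top[OF assms(1)]] u assms(2) by simp
  ultimately obtain i a where ia: "i \<in> zs \<eta>" "a \<in> {1..r}"
    "C_le (f u) (Some (\<eta>(i := Atom a)))"
    using ex_coatom_above[OF r_pos _ _ assms(3) C] by blast
  obtain c where c: "c \<in> ideal x" "f c = Some (\<eta>(i := Atom a))"
    using chart_surj[OF assms(1)] coatom_in_C_ideal[OF C, of i a] ia assms(2) by auto
  have "f c \<noteq> f x"
    using c ia assms(2) by (auto dest: fun_cong[of _ _ i])
  then have "c \<in> strictly_below P le x"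
    using c by (auto simp: strictly_below_def in_ideal)
  moreover have "le u c" using chart_le[OF assms(1) u(1) c(1)] c ia by simp
  ultimately have "c = u" using assms(4) by (simp add: facets_def)
  then show ?thesis using c ia u by blast
qed

section \<open>The intersections H_j as down-sets\<close>

lemma least_in_ideals: "\<exists>b\<in>P. \<forall>x\<in>P. b \<in> ideal x"
  using cubical unfolding r_cubical_def has_least_def by (auto simp: in_ideal)

lemma shelling_H_nonempty:
  assumes "0 < j" "j < length xs" "set xs \<subseteq> P"
  shows "shelling_H P le xs j \<noteq> {}"
proof -
  obtain b where "\<forall>x\<in>P. b \<in> ideal x" using least_in_ideals by blast
  moreover have "xs ! j \<in> P" "xs ! 0 \<in> P"
    using assms by (meson less_trans nth_mem subsetD)+
  ultimately have "b \<in> shelling_H P le xs j"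
    using assms(1) unfolding shelling_H_def by blast
  then show ?thesis by blast
qed

lemma shelling_H_subset: "shelling_H P le xs j \<subseteq> P"
  unfolding shelling_H_def principal_ideal_def by auto

lemma shelling_H_down:
  assumes "y \<in> shelling_H P le xs j" "w \<in> ideal y" "j < length xs" "set xs \<subseteq> P"
  shows "w \<in> shelling_H P le xs j"
proof -
  obtain i where i: "i < j" "y \<in> ideal (xs ! i)" "y \<in> ideal (xs ! j)"
    using assms(1) unfolding shelling_H_def by auto
  moreover have "xs ! i \<in> P" "xs ! j \<in> P"
    using i assms(3,4) by (meson less_trans nth_mem subsetD)+
  ultimately have "w \<in> ideal (xs ! i)" "w \<in> ideal (xs ! j)"
    using ideal_trans assms(2) by blast+
  then show ?thesis using i(1) unfolding shelling_H_def by blast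
qed

text \<open>H_j is finite and closed downwards, hence determined by its facets.\<close>

lemma in_shelling_H_iff:
  assumes "j < length xs" "set xs \<subseteq> P"
  shows "y \<in> shelling_H P le xs j \<longleftrightarrow> y \<in> P \<and> (\<exists>u\<in>facets (shelling_H P le xs j) le. le y u)"
    (is "y \<in> ?H \<longleftrightarrow> _")
proof
  assume "y \<in> ?H"
  then show "y \<in> P \<and> (\<exists>u\<in>facets ?H le. le y u)"
    using ex_facet_above[OF finite_poset_subset[OF poset shelling_H_subset]] shelling_H_subset
    by blast
next
  assume "y \<in> P \<and> (\<exists>u\<in>facets ?H le. le y u)"
  then obtain u where "y \<in> ideal u" "u \<in> ?H" by (auto simp: facets_def in_ideal)
  then show "y \<in> ?H" using shelling_H_down[OF _ _ assms] by simp
qed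


section \<open>Initial segments of shellings of the boundary of a cube\<close>

text \<open>The atoms a for which the coatom of \<eta> with direction i and atom a is the image of a
  member of \<open>S\<close>; the cardinalities of these sets form the profile.\<close>

definition dirs :: "('a \<Rightarrow> C_elem) \<Rightarrow> (nat \<Rightarrow> M_elem) \<Rightarrow> 'a set \<Rightarrow> nat \<Rightarrow> nat set" where
  "dirs f \<eta> S i = {a \<in> {1..r}. Some (\<eta>(i := Atom a)) \<in> f ` S}"

lemma dirs_subset: "dirs f \<eta> S i \<subseteq> {1..r}"
  unfolding dirs_def by auto

text \<open>The coatoms of the last facet \<open>xs ! k\<close>, which is perpendicular to direction \<open>i\<close>, that lie in an
  earlier facet are its intersections with the earlier facets perpendicular to other directions.\<close>

lemma dirs_shelling_H:
  assumes x: "chart f x" "f x = Some \<eta>"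
    and xs: "distinct xs" "set xs = facets (strictly_below P le x) le" "k < length xs"
    and i: "i \<in> zs \<eta>" "f (xs ! k) = Some (\<eta>(i := Atom b))"
    and i': "i' \<in> zs \<eta>" "i' \<noteq> i"
  shows "dirs f (\<eta>(i := Atom b)) (facets (shelling_H P le xs k) le) i'
    = dirs f \<eta> (set (take (Suc k) xs)) i'"
proof -
  let ?H = "shelling_H P le xs k" and ?u = "xs ! k"
  have C: "Some \<eta> \<in> C_set r" using x unfolding chart_def by metis
  have ne: "zs \<eta> \<noteq> {}" using i by blast
  have coatom: "u \<in> ideal x \<and> (\<exists>j\<in>zs \<eta>. \<exists>a\<in>{1..r}. f u = Some (\<eta>(j := Atom a)))"
    if "u \<in> set xs" for u
    using facet_below_is_coatom[OF x ne] that xs(2) by simp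
  have xP: "x \<in> P" using x unfolding chart_def by simp
  have u: "?u \<in> ideal x" using coatom xs(3) by simp
  have fu: "chart f ?u" by (rule chart_restrict[OF x(1) u])
  have uP: "?u \<in> P" using u by (simp add: in_ideal)
  have Cu: "Some (\<eta>(i := Atom b)) \<in> C_set r" using fu i unfolding chart_def by metis
  have xsP: "set xs \<subseteq> P" using coatom by (auto simp: in_ideal)
  \<comment> \<open>Distinct facets are incomparable.\<close>
  have u_notin: "?u \<notin> ?H"
  proof
    assume "?u \<in> ?H"
    then obtain l where l: "l < k" "le ?u (xs ! l)"
      unfolding shelling_H_def by (auto simp: in_ideal)
    have "?u \<in> facets (strictly_below P le x) le" "xs ! l \<in> strictly_below P le x"
      using xs l nth_mem[of k xs] nth_mem[of l xs] by (auto simp: facets_def)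
    then have "xs ! l = ?u" using l by (auto simp: facets_def)
    then show False using xs l by (simp add: nth_eq_iff_index_eq)
  qed
  show ?thesis
  proof (intro set_eqI iffI)
    fix a assume "a \<in> dirs f \<eta> (set (take (Suc k) xs)) i'"
    then obtain w where a: "a \<in> {1..r}" and w: "w \<in> set (take (Suc k) xs)"
      "f w = Some (\<eta>(i' := Atom a))"
      unfolding dirs_def by auto
    then obtain l where l: "l < Suc k" "l < length xs" "w = xs ! l"
      by (auto simp: in_set_conv_nth)
    have "l \<noteq> k"
    proof
      assume "l = k"
      then have "\<eta>(i' := Atom a) = \<eta>(i := Atom b)" using w l i by simp
      then show False using i i' by (auto dest: fun_cong[of _ _ i])
    qed
    then have lk: "l < k" using l by simp
    have wx: "w \<in> ideal x" using coatom l by simp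
    \<comment> \<open>The meet of the coatoms \<open>?u\<close> and \<open>w\<close>, with both
      coordinates i and i' set to atoms.\<close>
    have "Some ((\<eta>(i := Atom b))(i' := Atom a)) \<in> C_ideal (f ?u)"
      using coatom_in_C_ideal[OF Cu, of i' a] i i' a by simp
    then obtain d where d: "d \<in> ideal ?u" "f d = Some ((\<eta>(i := Atom b))(i' := Atom a))"
      using chart_surj[OF fu] by blast
    have dx: "d \<in> ideal x" using ideal_trans d u xP by blast
    have "C_le (f d) (f w)" using d w i' i by (auto simp: M_le_def)
    then have "d \<in> ideal w" using chart_le[OF x(1) dx wx] dx by (simp add: in_ideal)
    then have dH: "d \<in> ?H" unfolding shelling_H_def using d l lk by auto
    \<comment> \<open>As d is a coatom of the ideal of \<open>?u\<close>, only d and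
      \<open>?u\<close> lie above it there, and \<open>?u\<close> is not in
      \<open>?H\<close>.\<close>
    have "d \<in> facets ?H le"
      unfolding facets_def
    proof (intro CollectI conjI ballI impI dH)
      fix y assume y: "y \<in> ?H" "le d y"
      then have yu: "y \<in> ideal ?u" unfolding shelling_H_def by simp
      have "C_le (f d) (f y)" using chart_le[OF fu d(1) yu] y by simp
      moreover have "C_le (f y) (f ?u)"
        using chart_le[OF fu yu chart_top[OF fu]] yu by (simp add: in_ideal)
      ultimately have "f y = f d \<or> f y = f ?u"
        using coatom_cover[of "\<eta>(i := Atom b)" i' a "f y"] d i by simp
      then have "y = d \<or> y = ?u"
        using chart_inj[OF fu yu] d(1) chart_top[OF fu] by blast
      then show "y = d" using y u_notin by blast
    qed
    then show "a \<in> dirs f (\<eta>(i := Atom b)) (facets ?H le) i'"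
      using a d unfolding dirs_def by (auto simp: image_iff intro!: bexI[of _ d])
  next
    fix a assume "a \<in> dirs f (\<eta>(i := Atom b)) (facets ?H le) i'"
    then obtain d where a: "a \<in> {1..r}" and d: "d \<in> ?H"
      "f d = Some ((\<eta>(i := Atom b))(i' := Atom a))"
      unfolding dirs_def facets_def by auto
    then obtain l where l: "l < k" "d \<in> ideal (xs ! l)" unfolding shelling_H_def by auto
    let ?w = "xs ! l"
    have wxs: "?w \<in> set xs" using l xs(3) by simp
    then obtain j c where w: "?w \<in> ideal x" "j \<in> zs \<eta>" "f ?w = Some (\<eta>(j := Atom c))"
      using coatom by blast
    have "d \<in> ideal x" using l w ideal_trans xP by blast
    then have "C_le (f d) (f ?w)" using chart_le[OF x(1) _ w(1)] l by (simp add: in_ideal)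
    then have j: "((\<eta>(i := Atom b))(i' := Atom a)) j = Atom c"
      unfolding d w by (auto simp: M_le_def dest!: spec[of _ j])
    \<comment> \<open>Otherwise c = b, and two distinct facets would have the same image under
      \<open>f\<close>.\<close>
    have "j \<noteq> i"
    proof
      assume "j = i"
      then have "f ?w = f ?u" using j w i i' by simp
      then have "?w = ?u" using chart_inj[OF x(1) w(1) u] by simp
      then show False using l xs by (simp add: nth_eq_iff_index_eq)
    qed
    then have "j = i'" "c = a" using j w(2) by (auto split: if_splits)
    then have "f ?w = Some (\<eta>(i' := Atom a))" using w by simp
    moreover have "?w \<in> set (take (Suc k) xs)"
      using l xs by (auto simp: in_set_conv_nth intro!: exI[of _ l])
    ultimately show "a \<in> dirs f \<eta> (set (take (Suc k) xs)) i'"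
      using a unfolding dirs_def by (auto simp: image_iff intro!: bexI[of _ ?w])
  qed
qed

text \<open>Induction on the dimension of the cube: the last facet of the initial segment is a cube of
  smaller dimension, and its intersection with the earlier ones is again an initial segment.\<close>

lemma shelling_profile:
  assumes "chart f x" "f x = Some \<eta>" "zs \<eta> \<noteq> {}"
    and "C_shelling le (strictly_below P le x) (us @ vs)" "us \<noteq> []"
  shows "(\<exists>i\<in>zs \<eta>. card (dirs f \<eta> (set us) i) = 1) \<or> (\<forall>i\<in>zs \<eta>. dirs f \<eta> (set us) i \<noteq> {})"
  using assms
proof (induction "card (zs \<eta>)" arbitrary: x \<eta> us vs rule: less_induct)
  case less
  note x = less.prems(1,2) and ne = less.prems(3) and shell = less.prems(4)
  define xs where "xs = us @ vs"
  \<comment> \<open>The index of the last facet in \<open>us\<close>; the facets before it are those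
    with smaller index.\<close>
  define k where "k = length us - 1"
  have us: "us = take (Suc k) xs" using less.prems(5) unfolding xs_def k_def by simp
  have k: "k < length xs" using less.prems(5) unfolding xs_def k_def by (cases us) auto
  have xs: "distinct xs" "set xs = facets (strictly_below P le x) le"
    using C_shelling_facets[OF shell] unfolding xs_def by auto
  have xP: "x \<in> P" using x unfolding chart_def by simp
  have C: "Some \<eta> \<in> C_set r" using x unfolding chart_def by metis
  have fin: "finite (zs \<eta>)" using C by (simp add: Some_in_C_set)
  let ?u = "xs ! k"
  have u_us: "?u \<in> set us" using us k by (auto simp: in_set_conv_nth intro!: exI[of _ k])
  obtain i b where u: "?u \<in> ideal x" and i: "i \<in> zs \<eta>" and b: "b \<in> {1..r}"
    and fu: "f ?u = Some (\<eta>(i := Atom b))"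
    using facet_below_is_coatom[OF x ne, of ?u] xs k nth_mem by blast
  have b_dirs: "b \<in> dirs f \<eta> (set us) i"
    using b fu u_us unfolding dirs_def by (auto simp: image_iff intro!: bexI[of _ ?u])
  show ?case
  proof (cases "zs \<eta> = {i}")
    \<comment> \<open>With i the only direction, b shows that every direction is nonempty.\<close>
    case True
    then show ?thesis using b_dirs by auto
  next
    case dim: False
    show ?thesis
    proof (cases "k = 0")
      \<comment> \<open>A single facet gives a direction with exactly one coatom.\<close>
      case True
      then have "set us = {?u}" using us k by (cases xs) auto
      then have "dirs f \<eta> (set us) i = {b}"
        using fu b unfolding dirs_def by (auto dest: fun_cong[of _ _ i])
      then show ?thesis using i by auto
    next
      case False
      have zs': "zs (\<eta>(i := Atom b)) = zs \<eta> - {i}" by (rule zs_upd)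
      have ne': "zs \<eta> - {i} \<noteq> {}" using dim i by auto
      have less': "card (zs (\<eta>(i := Atom b))) < card (zs \<eta>)"
        unfolding zs' using i fin by (intro psubset_card_mono) auto
      have chu: "chart f ?u" by (rule chart_restrict[OF x(1) u])
      have u_sb: "?u \<in> strictly_below P le x"
        using xs k nth_mem[of k xs] by (auto simp: facets_def)
      have xs_sb: "set xs \<subseteq> strictly_below P le x"
        using xs by (auto simp: facets_def)
      \<comment> \<open>This forces rank at least 2 on the boundary, so its shelling comes from
        \<open>step\<close>, whose last premise at k > 0 supplies the smaller initial
        segment.\<close>
      have "2 \<le> rho ?u"
      proof -
        have "finite (zs \<eta> - {i})" using fin by simp
        then have "1 \<le> card (zs (\<eta>(i := Atom b)))"
          unfolding zs' using ne' by (metis One_nat_def Suc_leI card_gt_0_iff)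
        then show ?thesis
          using rho_chart[OF x(1) u] fu by (simp del: fun_upd_apply)
      qed
      moreover have "ideal ?u \<subseteq> strictly_below P le x"
      proof
        fix w assume w: "w \<in> ideal ?u"
        then have "w \<in> ideal x" using u xP ideal_trans by blast
        moreover have "w \<noteq> x"
          using w u_sb le_antisym xP by (auto simp: in_ideal strictly_below_def)
        ultimately show "w \<in> strictly_below P le x"
          by (auto simp: in_ideal strictly_below_def)
      qed
      ultimately have rank2: "2 \<le> poset_rank (strictly_below P le x) le"
        using chain_le_poset_rank[OF strictly_below_subset, of ?u] u
        by (force simp: in_ideal)
      have "\<exists>us' vs'. C_shelling le (strictly_below (strictly_below P le x) le ?u) (us' @ vs') \<and>
          set us' = facets (shelling_H (strictly_below P le x) le xs k) le"
        using shell[folded xs_def]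
      proof cases
        case low_rank
        then show ?thesis using rank2 by simp
      next
        case step
        then show ?thesis using False k by blast
      qed
      then obtain us' vs' where us': "C_shelling le (strictly_below P le ?u) (us' @ vs')"
        "set us' = facets (shelling_H P le xs k) le"
        using strictly_below_strictly_below[OF poset xP u_sb]
          shelling_H_strictly_below[OF poset xP xs_sb k] by auto
      have xsP: "set xs \<subseteq> P" using xs_sb strictly_below_subset by fast
      have "us' \<noteq> []"
        using us'(2) shelling_H_nonempty[OF _ k xsP] False in_shelling_H_iff[OF k xsP]
        by auto
      then have IH: "(\<exists>i'\<in>zs \<eta> - {i}. card (dirs f (\<eta>(i := Atom b)) (set us') i') = 1) \<or>
          (\<forall>i'\<in>zs \<eta> - {i}. dirs f (\<eta>(i := Atom b)) (set us') i' \<noteq> {})"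
        using less.hyps[OF less' chu fu _ us'(1)] ne' unfolding zs' by simp
      have "dirs f (\<eta>(i := Atom b)) (set us') i' = dirs f \<eta> (set us) i'"
        if "i' \<in> zs \<eta> - {i}" for i'
        unfolding us'(2) us using dirs_shelling_H[OF x xs k i fu] that by simp
      \<comment> \<open>A singleton in a direction other than i persists; if all those directions
        are nonempty, so is i, which contains b.\<close>
      then show ?thesis
        using IH b_dirs by auto
    qed
  qed
qed


section \<open>Summing over the pieces of the shelling\<close>

text \<open>The chart carries \<open>A\<close> onto a box and \<open>rho\<close> to
  \<open>C_rank\<close>. In the applications \<open>B i\<close> collects the atoms of the coatoms
  cut off in direction i.\<close>

lemma sum_ideal_diff:
  assumes x: "chart f x" "f x = Some \<eta>"
    and B: "\<And>i. B i \<subseteq> {1..r}"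
    and A: "\<And>y. y \<in> A \<longleftrightarrow> y \<in> ideal x \<and> f y \<in> Some ` box \<eta> (\<lambda>i. M_set r - Atom ` B i)"
  shows "(\<Sum>y\<in>A. [:0, 1:] ^ rho y)
    = ([:0, 1:] * (\<Prod>i\<in>zs \<eta>. [:real r - real (card (B i)), 1:]) :: real poly)"
proof -
  let ?X = "box \<eta> (\<lambda>i. M_set r - Atom ` B i)"
  have C: "Some \<eta> \<in> C_set r" using x unfolding chart_def by metis
  have sub: "Some ` ?X \<subseteq> C_ideal (f x)"
    unfolding x(2) C_ideal_Some[OF C] by (auto simp: box_def)
  have "f ` A = Some ` ?X"
  proof (intro equalityI subsetI)
    fix c assume c: "c \<in> Some ` ?X"
    then obtain y where "y \<in> ideal x" "f y = c" using sub chart_surj[OF x(1)] by blast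
    then show "c \<in> f ` A" using c A by blast
  next
    fix c assume "c \<in> f ` A"
    then show "c \<in> Some ` ?X" using A by blast
  qed
  moreover have "inj_on f A"
    using A chart_inj[OF x(1)] by (auto simp: inj_on_def)
  ultimately have bij: "bij_betw f A (Some ` ?X)" unfolding bij_betw_def by simp
  have "(\<Sum>y\<in>A. [:0, 1:] ^ rho y) = (\<Sum>y\<in>A. [:0, 1:] ^ C_rank (f y) :: real poly)"
    using A rho_chart[OF x(1)] by (intro sum.cong) auto
  also have "\<dots> = (\<Sum>c\<in>Some ` ?X. [:0, 1:] ^ C_rank c)"
    by (rule sum.reindex_bij_betw[OF bij])
  also have "\<dots> = (\<Sum>\<xi>\<in>?X. [:0, 1:] ^ C_rank (Some \<xi>))"
    by (subst sum.reindex) auto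
  also have "\<dots> = [:0, 1:] * (\<Prod>i\<in>zs \<eta>. [:real r - real (card (B i)), 1:])"
    using C B by (intro sum_C_rank_box) (auto simp: Some_in_C_set)
  finally show ?thesis .
qed

text \<open>With no coatom cut off, the elements above the least one contribute t (r + t)^(n-1) for
  n the rank of x, and the least one contributes 1.\<close>

lemma sum_ideal:
  assumes "x \<in> P" "0 < rho x"
  shows "(\<Sum>y\<in>ideal x. [:0, 1:] ^ rho y) = R_poly r (rho x) 0"
proof -
  obtain f where f: "chart f x" using ex_chart assms by blast
  note rx = rho_chart[OF f chart_top[OF f]]
  obtain \<eta> where \<eta>: "f x = Some \<eta>" using assms rx by (cases "f x") auto
  have C: "Some \<eta> \<in> C_set r" using f \<eta> unfolding chart_def by metis
  have I: "C_ideal (f x) = insert None (Some ` box \<eta> (\<lambda>_. M_set r))"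
    using C_ideal_Some[OF C] \<eta> by simp
  have "None \<in> C_ideal (f x)" using I by simp
  then obtain b where b: "b \<in> ideal x" "f b = None" using chart_surj[OF f] by blast
  have "(\<Sum>y\<in>ideal x - {b}. [:0, 1:] ^ rho y)
      = ([:0, 1:] * (\<Prod>i\<in>zs \<eta>. [:real r - real (card ({} :: nat set)), 1:]) :: real poly)"
  proof (rule sum_ideal_diff[OF f \<eta>, where B = "\<lambda>_. {}" and A = "ideal x - {b}"])
    fix y
    have "f y \<in> Some ` box \<eta> (\<lambda>_. M_set r) \<longleftrightarrow> y \<noteq> b" if "y \<in> ideal x"
      using chart_in_C_ideal[OF f that] chart_inj[OF f that b(1)] b I by auto
    then show "y \<in> ideal x - {b} \<longleftrightarrow>
        y \<in> ideal x \<and> f y \<in> Some ` box \<eta> (\<lambda>i. M_set r - Atom ` {})"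
      by auto
  qed simp
  moreover have "finite (ideal x)" using finite_P unfolding principal_ideal_def by simp
  moreover have "rho b = 0" using rho_chart[OF f b(1)] b by simp
  ultimately show ?thesis
    using sum.remove[of "ideal x" b "\<lambda>y. [:0, 1:] ^ rho y :: real poly"] b rx \<eta>
    unfolding R_poly_def by simp
qed

text \<open>The piece consists of the elements of the cube under none of the coatoms in
  \<open>us\<close>. These coatoms begin a shelling of the boundary, so
  \<open>shelling_profile\<close> applies to the product that describes the piece.\<close>

lemma sum_shelling_piece:
  assumes "0 < j" "j < length xs" "set xs \<subseteq> P" "2 \<le> rho (xs ! j)"
    and "C_shelling le (strictly_below P le (xs ! j)) (us @ vs)"
    and "set us = facets (shelling_H P le xs j) le"
  shows "(\<Sum>y\<in>ideal (xs ! j) - shelling_H P le xs j. [:0, 1:] ^ rho y)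
    \<in> R_cone r (rho (xs ! j))"
proof -
  let ?x = "xs ! j" and ?H = "shelling_H P le xs j"
  have xP: "?x \<in> P" using assms by auto
  obtain f where f: "chart f ?x" using ex_chart xP by blast
  note rx = rho_chart[OF f chart_top[OF f]]
  obtain \<eta> where \<eta>: "f ?x = Some \<eta>" using assms rx by (cases "f ?x") auto
  have C: "Some \<eta> \<in> C_set r" using f \<eta> unfolding chart_def by metis
  have fin: "finite (zs \<eta>)" using C by (simp add: Some_in_C_set)
  have rank: "rho ?x = Suc (card (zs \<eta>))" using rx \<eta> by simp
  have ne: "zs \<eta> \<noteq> {}"
  proof
    assume "zs \<eta> = {}"
    then have "card (zs \<eta>) = 0" by (simp only: card.empty)
    then show False using rank assms(4) by simp
  qed
  obtain h where h: "h \<in> ?H" using shelling_H_nonempty[OF assms(1-3)] by blast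
  have "us \<noteq> []"
    using h in_shelling_H_iff[OF assms(2,3), of h] assms(6) by auto
  note profile = shelling_profile[OF f \<eta> ne assms(5) this]
  let ?B = "dirs f \<eta> (set us)"
  have coatom: "u \<in> ideal ?x \<and> (\<exists>i\<in>zs \<eta>. \<exists>a\<in>{1..r}. f u = Some (\<eta>(i := Atom a)))"
    if "u \<in> set us" for u
  proof (rule facet_below_is_coatom[OF f \<eta> ne])
    show "u \<in> facets (strictly_below P le ?x) le"
      using C_shelling_facets[OF assms(5)] that by auto
  qed
  have "(\<Sum>y\<in>ideal ?x - ?H. [:0, 1:] ^ rho y)
      = ([:0, 1:] * (\<Prod>i\<in>zs \<eta>. [:real r - real (card (?B i)), 1:]) :: real poly)"
  proof (rule sum_ideal_diff[OF f \<eta>, where B = ?B and A = "ideal ?x - ?H"])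
    show "?B i \<subseteq> {1..r}" for i by (rule dirs_subset)
  next
    fix y
    have "y \<in> ?H \<longleftrightarrow> f y \<notin> Some ` box \<eta> (\<lambda>i. M_set r - Atom ` ?B i)" if y: "y \<in> ideal ?x"
    proof (cases "f y")
      \<comment> \<open>Here y is the least element, which lies in the nonempty down-set
        \<open>?H\<close>.\<close>
      case None
      have "h \<in> ideal ?x" using h unfolding shelling_H_def by simp
      then have "le y h" using chart_le[OF f y] None by simp
      then have "y \<in> ?H" using shelling_H_down[OF h _ assms(2,3)] y by (simp add: in_ideal)
      then show ?thesis using None by auto
    next
      case (Some \<xi>)
      have \<xi>: "\<xi> \<in> box \<eta> (\<lambda>_. M_set r)"
        using chart_in_C_ideal[OF f y] Some \<eta> C_ideal_Some[OF C] by auto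
      have \<xi>_le: "C_le (Some \<xi>) (Some \<eta>)"
        using chart_in_C_ideal[OF f y] Some \<eta> by (simp add: principal_ideal_def)
      have "y \<in> ?H \<longleftrightarrow> (\<exists>u\<in>set us. le y u)"
        using in_shelling_H_iff[OF assms(2,3)] assms(6) y by (simp add: in_ideal)
      also have "\<dots> \<longleftrightarrow> (\<exists>u\<in>set us. C_le (Some \<xi>) (f u))"
        using chart_le[OF f y] coatom unfolding Some by blast
      also have "\<dots> \<longleftrightarrow> (\<exists>i\<in>zs \<eta>. \<exists>a\<in>?B i. C_le (Some \<xi>) (Some (\<eta>(i := Atom a))))"
        (is "?L \<longleftrightarrow> ?R")
      proof
        assume ?L
        then obtain u where u: "u \<in> set us" "C_le (Some \<xi>) (f u)" by blast
        then obtain i a where ia: "i \<in> zs \<eta>" "a \<in> {1..r}" "f u = Some (\<eta>(i := Atom a))"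
          using coatom by blast
        then have "a \<in> ?B i" using u unfolding dirs_def by (auto simp: image_iff intro!: bexI[of _ u])
        then show ?R using u(2) ia by metis
      next
        assume ?R
        then obtain i a where a: "a \<in> ?B i" "C_le (Some \<xi>) (Some (\<eta>(i := Atom a)))"
          by blast
        then have "Some (\<eta>(i := Atom a)) \<in> f ` set us" unfolding dirs_def by blast
        then obtain u where u: "u \<in> set us" "Some (\<eta>(i := Atom a)) = f u" by blast
        show ?L using a(2) u(1) unfolding u(2) by blast
      qed
      also have "\<dots> \<longleftrightarrow> (\<exists>i\<in>zs \<eta>. \<exists>a\<in>?B i. \<xi> i = Atom a)"
        using C_le_coatom[OF \<xi>_le] by blast
      also have "\<dots> \<longleftrightarrow> \<xi> \<notin> box \<eta> (\<lambda>i. M_set r - Atom ` ?B i)"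
        using \<xi> unfolding box_def by auto
      finally show ?thesis using Some by auto
    qed
    then show "y \<in> ideal ?x - ?H \<longleftrightarrow>
        y \<in> ideal ?x \<and> f y \<in> Some ` box \<eta> (\<lambda>i. M_set r - Atom ` ?B i)"
      by blast
  qed
  also have "\<dots> \<in> R_cone r (Suc (card (zs \<eta>)))"
  proof (rule profile_in_R_cone[OF r_pos fin ne])
    fix i
    show "card (?B i) \<le> r" using card_mono[OF _ dirs_subset[of f \<eta> "set us" i]] by simp
  next
    have "card (?B i) \<noteq> 0 \<longleftrightarrow> ?B i \<noteq> {}" for i
      unfolding dirs_def by (simp add: card_eq_0_iff)
    then show "(\<exists>i\<in>zs \<eta>. card (?B i) = 1) \<or> (\<forall>i\<in>zs \<eta>. card (?B i) \<noteq> 0)"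
      using profile by (simp only: simp_thms)
  qed
  finally show ?thesis using rank by simp
qed

text \<open>A maximal chain through the facet x stays below x, and \<open>rho\<close> is injective
  on it, so it has at most rho x + 1 elements. By purity it is as long as one extending a chain
  below an element of maximal rank.\<close>

lemma rho_facet:
  assumes "pure_poset P le" "x \<in> facets P le"
  shows "rho x = cubical_rank r P le"
proof -
  have xP: "x \<in> P" using assms unfolding facets_def by simp
  have fin: "finite (rho ` P)" "rho ` P \<noteq> {}" using finite_P xP by auto
  obtain y where y: "y \<in> P" "rho y = cubical_rank r P le"
    using Max_in[OF fin] unfolding cubical_rank_def by auto
  obtain C where C: "pred_on.chain (ideal y) le C" "card C = Suc (rho y)"
    using ex_chain y by blast
  then have "pred_on.chain P le C" by (auto simp: pred_on.chain_def in_ideal)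
  then obtain D where D: "pred_on.maxchain P le D" "C \<subseteq> D"
    using ex_maxchain_superset finite_P by blast
  have "pred_on.chain P le {x}" using xP by (simp add: pred_on.chain_def)
  then obtain E where E: "pred_on.maxchain P le E" "x \<in> E"
    using ex_maxchain_superset[OF finite_P] by blast
  have E_chain: "E \<subseteq> P" "\<And>u w. u \<in> E \<Longrightarrow> w \<in> E \<Longrightarrow> le u w \<or> le w u"
    using E le_refl by (auto simp: pred_on.maxchain_def pred_on.chain_def)
  have inj: "inj_on rho E"
  proof (rule inj_onI)
    fix u w assume "u \<in> E" "w \<in> E" "rho u = rho w"
    then show "u = w"
      using rho_strict_mono[of u w] rho_strict_mono[of w u] E_chain by (auto simp: subset_iff)
  qed
  have "rho ` E \<subseteq> {..rho x}"
  proof (intro image_subsetI)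
    fix u assume u: "u \<in> E"
    have "le u x" "u \<in> P"
      using E_chain u E(2) assms(2) by (auto simp: facets_def)
    then show "rho u \<in> {..rho x}"
      using rho_strict_mono[of u x] xP by (cases "u = x") auto
  qed
  then have "card E \<le> Suc (rho x)"
    using card_mono[of "{..rho x}" "rho ` E"] card_image[OF inj] by simp
  moreover have "card C \<le> card D"
  proof (rule card_mono[OF _ D(2)])
    show "finite D"
      using D finite_P by (auto simp: pred_on.maxchain_def pred_on.chain_def intro: finite_subset)
  qed
  moreover have "card D = card E" using assms D E unfolding pure_poset_def by blast
  moreover have "rho x \<le> cubical_rank r P le"
    unfolding cubical_rank_def using fin xP by (intro Max_ge) auto
  ultimately show ?thesis using C y by simp
qed

text \<open>Every element except the least has rank exactly n, so the sum is 1 + (card P - 1)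
  t^n.\<close>

lemma sum_low_rank:
  assumes "cubical_rank r P le \<le> 1"
  shows "(\<Sum>x\<in>P. [:0, 1:] ^ rho x) \<in> R_cone r (cubical_rank r P le)"
proof -
  let ?n = "cubical_rank r P le"
  obtain b where b: "b \<in> P" "\<forall>x\<in>P. b \<in> ideal x" using least_in_ideals by blast
  have le_n: "rho x \<le> ?n" if "x \<in> P" for x
    unfolding cubical_rank_def using that finite_P by (intro Max_ge) auto
  have pos: "0 < rho x" if "x \<in> P - {b}" for x
    using rho_strict_mono[of b x] that b by (auto simp: in_ideal)
  have "rho b = 0"
  proof (rule ccontr)
    assume "rho b \<noteq> 0"
    then obtain y where "y \<in> ideal b" and "Suc (rho y) = rho b"
      using ex_below_of_rank[OF b(1)] by (metis not0_implies_Suc)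
    moreover have "y = b" using \<open>y \<in> ideal b\<close> b le_antisym[of y b] by (auto simp: in_ideal)
    ultimately show False by simp
  qed
  then have "(\<Sum>x\<in>P. [:0, 1:] ^ rho x) = 1 + (\<Sum>x\<in>P - {b}. [:0, 1:] ^ rho x :: real poly)"
    using sum.remove[OF finite_P b(1), of "\<lambda>x. [:0, 1:] ^ rho x :: real poly"] by simp
  also have "\<dots> = 1 + (\<Sum>x\<in>P - {b}. [:0, 1:] ^ ?n :: real poly)"
  proof (intro arg_cong[of _ _ "(+) 1"] sum.cong refl)
    fix x assume x: "x \<in> P - {b}"
    then have "rho x = ?n" using pos[OF x] le_n[of x] assms by simp
    then show "[:0, 1:] ^ rho x = ([:0, 1:] ^ ?n :: real poly)" by simp
  qed
  also have "\<dots> \<in> R_cone r ?n"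
  proof (cases "?n = 0")
    case True
    have empty: "P - {b} = {}"
    proof (rule equals0I)
      fix x assume x: "x \<in> P - {b}"
      then show False using pos[OF x] le_n[of x] True by simp
    qed
    have "R_poly r 0 0 \<in> R_cone r 0" by (rule R_poly_in_R_cone) simp
    then show ?thesis unfolding empty using True by (simp add: R_poly_def)
  next
    case False
    then have n: "?n = 1" using assms by simp
    have "?n \<in> rho ` P" unfolding cubical_rank_def using finite_P b by (intro Max_in) auto
    then obtain x where "x \<in> P" "rho x = 1" using n by auto
    then have "P - {b} \<noteq> {}" using \<open>rho b = 0\<close> by auto
    then obtain m where m: "card (P - {b}) = Suc m"
      using finite_P by (metis card_0_eq finite_Diff not0_implies_Suc)
    \<comment> \<open>R_{1,0} = 1 + t accounts for the least element and one of the m + 1 others;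
      the remaining m give R_{1,1} = t each.\<close>
    have "R_poly r 1 0 + smult (real m) (R_poly r 1 1) \<in> R_cone r 1"
      by (intro R_cone_add R_cone_smult R_poly_in_R_cone) auto
    moreover have "R_poly r 1 0 + smult (real m) (R_poly r 1 1)
        = 1 + (\<Sum>x\<in>P - {b}. [:0, 1:] ^ ?n)"
      unfolding n sum_constant m R_poly_def by (simp add: of_nat_poly)
    ultimately show ?thesis using n by simp
  qed
  finally show ?thesis .
qed

text \<open>The pieces are disjoint and exhaust \<open>P\<close>, as every element lies under a
  facet; each piece contributes a polynomial in the cone.\<close>

lemma sum_in_R_cone:
  assumes "pure_poset P le" "C_shelling le P xs" "2 \<le> cubical_rank r P le"
  shows "(\<Sum>x\<in>P. [:0, 1:] ^ rho x) \<in> R_cone r (cubical_rank r P le)"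
proof -
  let ?n = "cubical_rank r P le"
  let ?U = "\<lambda>k. \<Union>i<k. ideal (xs ! i)"
  have xs: "set xs = facets P le" using C_shelling_facets[OF assms(2)] by simp
  then have xsP: "set xs \<subseteq> P" by (auto simp: facets_def)
  have rank: "rho (xs ! j) = ?n" if "j < length xs" for j
    using rho_facet[OF assms(1)] xs nth_mem[OF that] by simp
  have piece: "(\<Sum>y\<in>ideal (xs ! j) - shelling_H P le xs j. [:0, 1:] ^ rho y) \<in> R_cone r ?n"
    if j: "j < length xs" for j
  proof (cases "j = 0")
    \<comment> \<open>Nothing precedes the first facet, so its piece is a whole cube.\<close>
    case True
    have "shelling_H P le xs 0 = {}" unfolding shelling_H_def by simp
    moreover have "R_poly r ?n 0 \<in> R_cone r ?n" by (rule R_poly_in_R_cone) simp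
    ultimately show ?thesis
      using True sum_ideal[of "xs ! j"] rank[OF j] assms(3) xsP nth_mem[OF j]
      by (auto simp: subset_iff)
  next
    case False
    have x: "xs ! j \<in> P" using xsP j by auto
    have rank2: "2 \<le> poset_rank P le"
      using chain_le_poset_rank[of P "xs ! j"] x rank[OF j] assms(3)
      by (auto simp: principal_ideal_def)
    have "\<exists>us vs. C_shelling le (strictly_below P le (xs ! j)) (us @ vs) \<and>
        set us = facets (shelling_H P le xs j) le"
      using assms(2)
    proof cases
      case low_rank
      then show ?thesis using rank2 by simp
    next
      case step
      then show ?thesis using False j by blast
    qed
    then show ?thesis
      using sum_shelling_piece[OF _ j xsP] False rank[OF j] assms(3) by auto
  qed
  have partial: "k \<le> length xs \<Longrightarrow> (\<Sum>y\<in>?U k. [:0, 1:] ^ rho y) \<in> R_cone r ?n" for k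
  proof (induction k)
    case 0
    show ?case by (simp add: R_cone_0)
  next
    case (Suc k)
    have "?U (Suc k) = ?U k \<union> (ideal (xs ! k) - shelling_H P le xs k)"
      unfolding shelling_H_def by (auto simp: less_Suc_eq)
    moreover have "?U k \<inter> (ideal (xs ! k) - shelling_H P le xs k) = {}"
      unfolding shelling_H_def by auto
    moreover have "finite (ideal y)" for y using finite_P unfolding principal_ideal_def by simp
    then have "finite (?U k)" "finite (ideal (xs ! k) - shelling_H P le xs k)" by blast+
    ultimately have "(\<Sum>y\<in>?U (Suc k). [:0, 1:] ^ rho y) = (\<Sum>y\<in>?U k. [:0, 1:] ^ rho y)
        + (\<Sum>y\<in>ideal (xs ! k) - shelling_H P le xs k. [:0, 1:] ^ rho y :: real poly)"
      by (simp only: sum.union_disjoint)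
    then show ?case using Suc piece[of k] by (simp add: R_cone_add)
  qed
  have "P = ?U (length xs)"
  proof (intro set_eqI iffI)
    fix y assume "y \<in> P"
    then obtain u where "u \<in> set xs" "le y u" using ex_facet_above[OF poset] xs by blast
    then show "y \<in> ?U (length xs)" using \<open>y \<in> P\<close> by (auto simp: in_set_conv_nth in_ideal)
  qed (auto simp: in_ideal)
  then show ?thesis using partial[of "length xs"] by simp
qed

end

theorem theorem8p7:
  fixes r n :: nat and P :: "'a set" and le :: "'a \<Rightarrow> 'a \<Rightarrow> bool"
  assumes "r \<ge> 1"
    and "r_cubical r P le"
    and "pure_poset P le"
    and "cubical_rank r P le = n"
    and "C_shellable P le"
  shows "(\<exists>h :: nat \<Rightarrow> real. (\<forall>k\<le>n. 0 \<le> h k) \<and>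
           (\<Sum>x\<in>P. [:0, 1:] ^ cubical_rho r P le x) = (\<Sum>k\<le>n. smult (h k) (R_poly r n k)))
         \<and> C_positive r P le"
proof -
  interpret cubical_poset r P le
    by unfold_locales (rule assms)+
  obtain xs where "C_shelling le P xs" using assms unfolding C_shellable_def by blast
  \<comment> \<open>Rank at most one is counted directly, since C-shellings put no condition on
    intersections there.\<close>
  then have "(\<Sum>x\<in>P. [:0, 1:] ^ cubical_rho r P le x) \<in> R_cone r n"
    using sum_low_rank sum_in_R_cone[OF assms(3)] assms(4) by (cases "n \<le> 1") simp_all
  then show ?thesis
    using assms(4)
    unfolding R_cone_def C_positive_def is_cubical_h_vector_def rank_generating_poly_def
    by blast
qed

end
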